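(* Assume $n$ is an even positive integer. (a) The involutions $A$ and $B$ in $\mathrm{TO}(n)$ are in the same conjugacy class of $\mathrm{TO}(n)$ if and only if $DD(A)=DD(B)$. (b) There are precisely $5n-4$ conjugacy classes of involutions in $\mathrm{TO}(2n)$, and they are represented by the following three families of matrices: \begin{itemize} \item $I^{\oplus(n-k)}\oplus J^{\oplus(k)}$ for $1\leq k\leq n-1$, together with their mirrors; \item $m\bigl(I^{\oplus(n-k)}\bigr)\oplus J^{\oplus(k)}$ for $0\leq k\leq n-1$, together with their mirrors; \item $m\bigl(I^{\oplus(n-k-1)}\oplus J^{\oplus(k)}\bigr)\oplus J$ for $1\leq k\leq n-2$. \end{itemize}
   Context: For $N\ge 1$, $\mathrm{TO}(N)$ is the group of $N\times N$ matrices $A$ over $\mathbb{F}_2$ with $A^TA=I_N$ (where $I_N$ is the $N\times N$ identity matrix), i.e. the isometry group of $\mathbb{F}_2^N$ with the standard dot product. An involution is an element $A$ with $A^2=\mathrm{Id}$ (the identity is included). For a square matrix $A$ over $\mathbb{F}_2$, the mirror $m(A)$ of $A$ is the matrix obtained by changing every entry ($0$ changes to $1$ and $1$ changes to $0$). If $N$ is even and $A\in\mathrm{TO}(N)$ then $m(A)\in\mathrm{TO}(N)$, and the mirror of an involution in $\mathrm{TO}(N)$ is again an involution. For an involution $A\in \mathrm{TO}(N)$: $D(A)=\mathrm{rank}(A+\mathrm{Id})$ over $\mathbb{F}_2$; $\alpha(A)\in\{0,1\}$ is the rank of the map $\mathbb{F}_2^N\to\mathbb{F}_2$, $v\mapsto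 v\cdot Av$ (which is linear), so $\alpha(A)=1$ if there is $v\in\mathbb{F}_2^N$ with $v\cdot Av=1$, and $\alpha(A)=0$ otherwise. For $N$ even put $\tilde D(A)=D(m(A))$, $\tilde\alpha(A)=\alpha(m(A))$ and $DD(A)=[D(A),\alpha(A),\tilde D(A),\tilde\alpha(A)]$. $A\oplus B$ denotes the block diagonal matrix with diagonal blocks $A$ and $B$, and $A^{\oplus(k)}$ is the $k$-fold block sum of $A$ with itself (empty if $k=0$). $I=\begin{bmatrix}1&0\\0&1\end{bmatrix}$ and $J=\begin{bmatrix}0&1\\1&0\end{bmatrix}$. *)

theory Defs
  imports "HOL-Library.Z2" "HOL-Algebra.Group_Action" "Jordan_Normal_Form.DL_Rank"
begin

text \<open>\<^typ>\<open>bit\<close> is the field with two elements. The order of a matrix is not part of its type,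
  so the group \<open>TO N\<close> carries \<open>N\<close> as an argument.\<close>

definition TO :: "nat \<Rightarrow> bit mat monoid" where
  "TO N = \<lparr>carrier = {A \<in> carrier_mat N N. transpose_mat A * A = 1\<^sub>m N},
           mult = (*), one = 1\<^sub>m N\<rparr>"

definition involutions :: "nat \<Rightarrow> bit mat set" where
  "involutions N = {A \<in> carrier (TO N). A * A = 1\<^sub>m N}"

definition conj_class :: "('a, 'b) monoid_scheme \<Rightarrow> 'a \<Rightarrow> 'a set" where
  "conj_class G x =
     orbit G (\<lambda>g. \<lambda>h \<in> carrier G. g \<otimes>\<^bsub>G\<^esub> h \<otimes>\<^bsub>G\<^esub> inv\<^bsub>G\<^esub> g) x"

definition mirror :: "bit mat \<Rightarrow> bit mat" where
  "mirror A = map_mat (\<lambda>x. x + 1) A"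

definition inv_D :: "bit mat \<Rightarrow> nat" where
  "inv_D A = vec_space.rank (dim_row A) (A + 1\<^sub>m (dim_row A))"

text \<open>The rank of the map sending \<open>v\<close> to \<open>v \<bullet> A v\<close> is the dimension of its image in the
  one-dimensional vector space \<^typ>\<open>bit\<close>. The function \<^term>\<open>vector_space.dim\<close> takes an
  arbitrary subset and returns the dimension of its span.\<close>

definition inv_alpha :: "bit mat \<Rightarrow> nat" where
  "inv_alpha A =
     vector_space.dim ((*) :: bit \<Rightarrow> bit \<Rightarrow> bit) ((\<lambda>v. v \<bullet> (A *\<^sub>v v)) ` carrier_vec (dim_row A))"

definition DD :: "bit mat \<Rightarrow> nat \<times> nat \<times> nat \<times> nat" where
  "DD A = (inv_D A, inv_alpha A, inv_D (mirror A), inv_alpha (mirror A))"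

definition block_sum :: "bit mat \<Rightarrow> bit mat \<Rightarrow> bit mat" (infixl \<open>\<oplus>\<^sub>b\<close> 65) where
  "A \<oplus>\<^sub>b B = diag_block_mat [A, B]"

definition block_pow :: "bit mat \<Rightarrow> nat \<Rightarrow> bit mat" where
  "block_pow A k = diag_block_mat (replicate k A)"

definition I2 :: "bit mat" where
  "I2 = mat_of_rows_list 2 [[1, 0], [0, 1]]"

definition J2 :: "bit mat" where
  "J2 = mat_of_rows_list 2 [[0, 1], [1, 0]]"

definition family1 :: "nat \<Rightarrow> bit mat set" where
  "family1 n = {block_pow I2 (n - k) \<oplus>\<^sub>b block_pow J2 k | k. 1 \<le> k \<and> k \<le> n - 1}"

definition family2 :: "nat \<Rightarrow> bit mat set" where
  "family2 n = {mirror (block_pow I2 (n - k)) \<oplus>\<^sub>b block_pow J2 k | k. k \<le> n - 1}"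

definition family3 :: "nat \<Rightarrow> bit mat set" where
  "family3 n =
     {mirror (block_pow I2 (n - k - 1) \<oplus>\<^sub>b block_pow J2 k) \<oplus>\<^sub>b J2 | k. 1 \<le> k \<and> k \<le> n - 2}"

definition representatives :: "nat \<Rightarrow> bit mat set" where
  "representatives n =
     family1 n \<union> mirror ` family1 n \<union> family2 n \<union> mirror ` family2 n \<union> family3 n"

lemma TO_carrier_iff:
  "A \<in> carrier (TO N) \<longleftrightarrow> A \<in> carrier_mat N N \<and> transpose_mat A * A = 1\<^sub>m N"
  by (simp add: TO_def)

lemma TO_transpose_right:
  assumes "A \<in> carrier (TO N)"
  shows "A * transpose_mat A = 1\<^sub>m N"
  using assms mat_mult_left_right_inverse[of "transpose_mat A" N A]
  by (simp add: TO_carrier_iff)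

lemma group_TO: "group (TO N)"
proof (rule groupI)
  fix A B assume A: "A \<in> carrier (TO N)" and B: "B \<in> carrier (TO N)"
  have cA: "A \<in> carrier_mat N N" and cB: "B \<in> carrier_mat N N"
    using A B by (auto simp: TO_carrier_iff)
  have "transpose_mat (A * B) * (A * B) = transpose_mat B * (transpose_mat A * A * B)"
    using cA cB by (simp add: transpose_mult[OF cA cB] assoc_mult_mat[of _ N N _ N _ N])
  also have "\<dots> = 1\<^sub>m N"
    using A B cB by (simp add: TO_carrier_iff)
  finally show "A \<otimes>\<^bsub>TO N\<^esub> B \<in> carrier (TO N)"
    using cA cB by (simp add: TO_def)
next
  fix A assume A: "A \<in> carrier (TO N)"
  show "\<exists>B\<in>carrier (TO N). B \<otimes>\<^bsub>TO N\<^esub> A = \<one>\<^bsub>TO N\<^esub>"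
    using A TO_transpose_right[OF A]
    by (intro bexI[of _ "transpose_mat A"]) (auto simp: TO_def)
qed (auto simp: TO_def assoc_mult_mat[of _ N N _ N _ N])

lemma TO_inv:
  assumes "A \<in> carrier (TO N)"
  shows "inv\<^bsub>TO N\<^esub> A = transpose_mat A"
proof -
  interpret group "TO N" by (rule group_TO)
  have "transpose_mat A \<in> carrier (TO N)"
    using assms TO_transpose_right[OF assms] by (simp add: TO_carrier_iff)
  then show ?thesis
    using assms by (intro inv_equality) (auto simp: TO_def)
qed

lemma conj_class_TO:
  assumes "A \<in> carrier (TO N)"
  shows "conj_class (TO N) A = {P * A * transpose_mat P | P. P \<in> carrier (TO N)}"
proof -
  have "mult (TO N) = (*)"
    by (simp add: TO_def)
  with assms show ?thesis
    by (force simp: conj_class_def orbit_def TO_inv)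
qed

lemma inv_alpha_eq:
  "inv_alpha A = (if \<exists>v \<in> carrier_vec (dim_row A). v \<bullet> (A *\<^sub>v v) = 1 then 1 else 0)"
proof -
  interpret V: vector_space "(*) :: bit \<Rightarrow> bit \<Rightarrow> bit"
    by unfold_locales (auto simp: algebra_simps)
  let ?S = "(\<lambda>v. v \<bullet> (A *\<^sub>v v)) ` carrier_vec (dim_row A)"
  have span1: "V.span {1} = UNIV"
    unfolding V.span_singleton by (metis mult.right_neutral surj_def)
  have ind: "V.independent {1}"
    unfolding V.dependent_single by simp
  show ?thesis
  proof (cases "1 \<in> ?S")
    case True
    have "V.dim ?S = card {1 :: bit}"
      using True ind span1 by (intro V.dim_unique) auto
    moreover have "\<exists>v \<in> carrier_vec (dim_row A). v \<bullet> (A *\<^sub>v v) = 1"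
      using True by (metis imageE)
    ultimately show ?thesis by (simp add: inv_alpha_def)
  next
    case False
    have "?S \<subseteq> {0}"
    proof
      fix x assume "x \<in> ?S"
      with False have "x \<noteq> 1" by blast
      then show "x \<in> {0}" by (cases x) auto
    qed
    then have "V.dim ?S = card ({} :: bit set)"
      using V.independent_empty by (intro V.dim_unique) (simp_all only: V.span_empty empty_subsetI not_False_eq_True)
    moreover have "\<not> (\<exists>v \<in> carrier_vec (dim_row A). v \<bullet> (A *\<^sub>v v) = 1)"
      using False by (metis imageI)
    ultimately show ?thesis by (simp add: inv_alpha_def)
  qed
qed

end

theory Submission
  imports Defs
begin

text \<open>For an involution \<open>A\<close> in \<open>TO N\<close> the matrix \<open>M = A + Id\<close> is symmetric with \<open>M\<^sup>2 = 0\<close>, so its image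
  \<open>U\<close> is totally isotropic, and \<open>M\<close> induces a nondegenerate symmetric form on \<open>U\<close>. If the diagonal
  of \<open>M\<close> does not vanish, this form has an orthonormal basis, that is, \<open>M\<close> is the sum of \<open>x x\<^sup>T\<close>
  over a basis of \<open>U\<close>; if it vanishes, the diagonal of the mirror does not (for \<open>N > 0\<close>). By a Witt
  extension argument with transvections, two independent isotropic lists of the same length are
  carried to each other by an element of \<open>TO N\<close>, provided the all-ones vector, which every element
  of \<open>TO N\<close> fixes, occupies the same position with respect to both. Up to taking mirrors, only three
  positions occur: outside \<open>U\<close>, the sum of the whole basis, and the sum of two of at least three
  basis vectors. \<open>DD\<close> separates these positions and the ranks, and the listed matrices realise each
  possibility once.\<close>

text \<open>Squaring is the identity on the field with two elements, so
  \<open>v \<bullet> v = v \<bullet> ones N\<close>. This is why isometries fix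
  \<open>ones N\<close>, and why Witt extension can fail once that vector lies in the span to be
  moved.

  Let b(M v, M w) = v \<bullet> M w be the form on the image U, and suppose that neither M nor its
  counterpart for the mirror has zero diagonal. If \<open>ones N\<close> = M y lies in U, then
  b(\<open>ones N\<close>, \<open>ones N\<close>) = y \<bullet> \<open>ones N\<close> decides. If it
  is 1, then y is killed by \<open>mirror A\<close> + Id, which forces \<open>ones N\<close> out of
  the image belonging to the mirror. If it is 0, then \<open>ones N\<close> is the sum of two
  b-orthonormal vectors; removing their squares from M leaves a matrix with diagonal
  \<open>diag_vec A\<close>, which again has an orthonormal basis, and this is the pair position. If
  \<open>diag_vec A\<close> vanishes, then M has diagonal \<open>ones N\<close>, and every
  orthonormal basis sums to it: the full position.

  The number 5n - 4 is 2(n - 1) + 2n + (n - 2): two outside families, two full ones, and one pair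
  family that is closed under mirroring.\<close>

section \<open>Vectors over the field with two elements\<close>

text \<open>These two simp rules turn the field operations into Boolean ones and so defeat ring normalisation.\<close>

declare add_bit_eq_xor [simp del] mult_bit_eq_and [simp del]

lemma bit_add_self [simp]: "a + a = (0 :: bit)"
  by (cases a) simp_all

lemma bit_add_left_cancel2 [simp]: "a + (a + b) = (b :: bit)"
  by (simp flip: add.assoc)

lemma bit_mult_self [simp]: "a * a = (a :: bit)"
  by (cases a) simp_all

lemma bit_add_eq_0_iff: "a + b = 0 \<longleftrightarrow> a = (b :: bit)"
  by (cases a; cases b) simp_all

lemma bvec_add_self [simp]: "v \<in> carrier_vec N \<Longrightarrow> v + v = 0\<^sub>v N" for v :: "bit vec"
  by (intro eq_vecI) auto

lemma bvec_add_cancel [simp]: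
  "u \<in> carrier_vec N \<Longrightarrow> v \<in> carrier_vec N \<Longrightarrow> u + (u + v) = v" for u v :: "bit vec"
  by (intro eq_vecI) auto

lemma bvec_add_eq_iff:
  assumes "u \<in> carrier_vec N" "v \<in> carrier_vec N" "w \<in> carrier_vec N"
  shows "u + v = w \<longleftrightarrow> v = u + (w :: bit vec)"
  using assms by (metis bvec_add_cancel)

lemma smult_bit_vec: "c \<cdot>\<^sub>v v = (if c = 0 then 0\<^sub>v (dim_vec v) else v)" for v :: "bit vec"
  by (intro eq_vecI) auto

lemma bmat_add_cancel:
  "A \<in> carrier_mat m n \<Longrightarrow> B \<in> carrier_mat m n \<Longrightarrow> A + (A + B) = B" for A B :: "bit mat"
  by (intro eq_matI) auto

lemma mat_eq_mult_vecI:
  assumes "A \<in> carrier_mat m n" "B \<in> carrier_mat m n"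
    and "\<And>v. v \<in> carrier_vec n \<Longrightarrow> A *\<^sub>v v = B *\<^sub>v (v :: 'a :: semiring_1 vec)"
  shows "A = B"
proof (rule eq_matI)
  fix i j assume ij: "i < dim_row B" "j < dim_col B"
  then have "(A *\<^sub>v unit_vec n j) $ i = (B *\<^sub>v unit_vec n j) $ i"
    using assms by simp
  then show "A $$ (i, j) = B $$ (i, j)"
    using ij assms(1,2) by (simp add: row_def)
qed (use assms in auto)

definition ones :: "nat \<Rightarrow> bit vec" where
  "ones N = vec N (\<lambda>_. 1)"

lemma ones_carrier [simp]: "ones N \<in> carrier_vec N" and dim_ones [simp]: "dim_vec (ones N) = N"
  and index_ones [simp]: "i < N \<Longrightarrow> ones N $ i = 1"
  by (simp_all add: ones_def)

lemma ones_neq_zero: "N > 0 \<Longrightarrow> ones N \<noteq> 0\<^sub>v N"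
  by (metis index_ones index_zero_vec(1) zero_neq_one)

lemma scalar_prod_ones: "v \<in> carrier_vec N \<Longrightarrow> v \<bullet> ones N = v \<bullet> v"
  by (simp add: scalar_prod_def)

lemma ones_scalar_prod_ones: "ones N \<bullet> ones N = of_nat N"
  by (simp add: scalar_prod_def)

lemma of_nat_bit: "of_nat k = (if even k then 0 else 1 :: bit)"
  by (induction k) auto

text \<open>A coefficient is 0 or 1, so x is either used or not, and x + v undoes its use. The
  recursion suits list induction; \<open>fspan_eq_span\<close> identifies the result with the
  library span.\<close>

fun fspan :: "nat \<Rightarrow> bit vec list \<Rightarrow> bit vec set" where
  "fspan N [] = {0\<^sub>v N}"
| "fspan N (x # xs) = {v \<in> carrier_vec N. v \<in> fspan N xs \<or> x + v \<in> fspan N xs}"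

lemma fspan_carrier: "v \<in> fspan N xs \<Longrightarrow> v \<in> carrier_vec N"
  by (induction xs) auto

lemma zero_in_fspan [simp]: "0\<^sub>v N \<in> fspan N xs"
  by (induction xs) auto

lemma fspan_add:
  "set xs \<subseteq> carrier_vec N \<Longrightarrow> u \<in> fspan N xs \<Longrightarrow> v \<in> fspan N xs \<Longrightarrow> u + v \<in> fspan N xs"
proof (induction xs arbitrary: u v)
  case (Cons x xs)
  have c: "x \<in> carrier_vec N" "u \<in> carrier_vec N" "v \<in> carrier_vec N"
    using Cons.prems by auto
  have 1: "x + u + v = x + (u + v)" "u + (x + v) = x + (u + v)" "(x + u) + (x + v) = u + v"
    using c by (auto intro!: eq_vecI simp: ac_simps)
  have "set xs \<subseteq> carrier_vec N" using Cons.prems by simp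
  note IH = Cons.IH[OF this]
  show ?case
    using Cons.prems IH[of u v] IH[of "x + u" v] IH[of u "x + v"] IH[of "x + u" "x + v"] c
    unfolding 1 by auto
qed simp

lemma fspan_add_iff:
  assumes "set xs \<subseteq> carrier_vec N" "u \<in> fspan N xs" "v \<in> carrier_vec N"
  shows "u + v \<in> fspan N xs \<longleftrightarrow> v \<in> fspan N xs"
proof -
  have "u + (u + v) = v" using assms fspan_carrier[OF assms(2)] by simp
  then show ?thesis using assms fspan_add by metis
qed

lemma fspan_mono_Cons: "v \<in> fspan N xs \<Longrightarrow> v \<in> fspan N (x # xs)"
  using fspan_carrier by auto

lemma set_subset_fspan: "set xs \<subseteq> carrier_vec N \<Longrightarrow> set xs \<subseteq> fspan N xs"
proof (induction xs)
  case (Cons x xs)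
  then show ?case by auto
qed simp

lemma fspan_subset:
  assumes "\<And>u v. u \<in> W \<Longrightarrow> v \<in> W \<Longrightarrow> u + v \<in> W" "0\<^sub>v N \<in> W" "set xs \<subseteq> W" "W \<subseteq> carrier_vec N"
  shows "fspan N xs \<subseteq> W"
  using assms(3)
proof (induction xs)
  case (Cons x xs)
  show ?case
  proof
    fix v assume v: "v \<in> fspan N (x # xs)"
    have "x \<in> W" "x \<in> carrier_vec N" using Cons.prems assms(4) by auto
    then have "x + (x + v) = v" using v by simp
    then show "v \<in> W" using v Cons \<open>x \<in> W\<close> assms(1)[of x "x + v"] by auto
  qed
qed (use assms in auto)

lemma fspan_orthogonal:
  assumes "set xs \<subseteq> carrier_vec N" "t \<in> carrier_vec N" "\<forall>x\<in>set xs. t \<bullet> x = 0" "v \<in> fspan N xs"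
  shows "t \<bullet> v = 0"
proof -
  have "fspan N xs \<subseteq> {v \<in> carrier_vec N. t \<bullet> v = 0}"
    using assms by (intro fspan_subset) (auto simp: scalar_prod_add_distrib[of _ N])
  then show ?thesis using assms(4) by auto
qed

text \<open>This is nondegeneracy of the dot product: a subspace is the annihilator of its
  annihilator. For the empty list it gives a vector that pairs to 1 with a given nonzero v.\<close>

lemma fspan_separating_vec:
  assumes "set xs \<subseteq> carrier_vec N" "v \<in> carrier_vec N" "v \<notin> fspan N xs"
  shows "\<exists>t\<in>carrier_vec N. (\<forall>x\<in>set xs. t \<bullet> x = 0) \<and> t \<bullet> v = 1"
  using assms
proof (induction xs arbitrary: v)
  case Nil
  then obtain i where i: "i < N" "v $ i = 1" by (auto simp: vec_eq_iff)
  then show ?case using Nil by (intro bexI[of _ "unit_vec N i"]) auto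
next
  case (Cons x xs)
  have c: "x \<in> carrier_vec N" "set xs \<subseteq> carrier_vec N" using Cons.prems by auto
  have "v \<notin> fspan N xs" "x + v \<notin> fspan N xs" using Cons.prems by auto
  with Cons.IH[OF c(2), of v] Cons.IH[OF c(2), of "x + v"] Cons.prems c obtain s t where
    s: "s \<in> carrier_vec N" "\<forall>y\<in>set xs. s \<bullet> y = 0" "s \<bullet> v = 1" and
    t: "t \<in> carrier_vec N" "\<forall>y\<in>set xs. t \<bullet> y = 0" "t \<bullet> (x + v) = 1" by auto
  have d: "t \<bullet> x + t \<bullet> v = 1"
    using t Cons.prems c by (simp add: scalar_prod_add_distrib[of _ N])
  have e: "(s + t) \<bullet> y = s \<bullet> y + t \<bullet> y" if "y \<in> carrier_vec N" for y
    using that s t by (simp add: add_scalar_prod_distrib[of _ N])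
  \<comment> \<open>s separates v, and t separates x + v, from the tail. One of s, t, s + t also
    annihilates x, and in its case it takes the value 1 on v.\<close>
  consider "s \<bullet> x = 0" | "t \<bullet> x = 0" | "s \<bullet> x = 1" "t \<bullet> x = 1" by fastforce
  then show ?case
  proof cases
    case 1 then show ?thesis using s by auto
  next
    case 2 then show ?thesis using t d by auto
  next
    case 3
    then have "t \<bullet> v = 0" using d by (cases "t \<bullet> v") auto
    then show ?thesis using 3 s t c Cons.prems e by (intro bexI[of _ "s + t"]) auto
  qed
qed

text \<open>The annihilator of xs is not the union of two proper subspaces: if neither separating
  vector serves both v and w, their sum does.\<close>

lemma fspan_separating_vec2:
  assumes "set xs \<subseteq> carrier_vec N" "v \<in> carrier_vec N" "v \<notin> fspan N xs"
    "w \<in> carrier_vec N" "w \<notin> fspan N xs"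
  shows "\<exists>t\<in>carrier_vec N. (\<forall>x\<in>set xs. t \<bullet> x = 0) \<and> t \<bullet> v = 1 \<and> t \<bullet> w = 1"
proof -
  from fspan_separating_vec[OF assms(1-3)] fspan_separating_vec[OF assms(1,4,5)] obtain s t where
    s: "s \<in> carrier_vec N" "\<forall>y\<in>set xs. s \<bullet> y = 0" "s \<bullet> v = 1" and
    t: "t \<in> carrier_vec N" "\<forall>y\<in>set xs. t \<bullet> y = 0" "t \<bullet> w = 1" by auto
  have e: "(s + t) \<bullet> y = s \<bullet> y + t \<bullet> y" if "y \<in> carrier_vec N" for y
    using that s t by (simp add: add_scalar_prod_distrib[of _ N])
  consider "s \<bullet> w = 1" | "t \<bullet> v = 1" | "s \<bullet> w = 0" "t \<bullet> v = 0" by fastforce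
  then show ?thesis
  proof cases
    case 3
    then show ?thesis using s t assms e by (intro bexI[of _ "s + t"]) auto
  qed (use s t in auto)
qed

fun indep :: "nat \<Rightarrow> bit vec list \<Rightarrow> bool" where
  "indep N [] = True"
| "indep N (x # xs) = (x \<notin> fspan N xs \<and> indep N xs)"

fun vsum :: "nat \<Rightarrow> bit vec list \<Rightarrow> bit vec" where
  "vsum N [] = 0\<^sub>v N"
| "vsum N (x # xs) = x + vsum N xs"

lemma vsum_carrier [simp]: "set xs \<subseteq> carrier_vec N \<Longrightarrow> vsum N xs \<in> carrier_vec N"
  by (induction xs) auto

lemma vsum_in_fspan: "set xs \<subseteq> carrier_vec N \<Longrightarrow> vsum N xs \<in> fspan N xs"
  by (induction xs) auto

lemma vsum_nonzero: 
  assumes "set xs \<subseteq> carrier_vec N" "indep N xs" "xs \<noteq> []"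
  shows "vsum N xs \<noteq> 0\<^sub>v N"
proof -
  obtain y ys where xs: "xs = y # ys" using assms(3) by (cases xs) auto
  have "vsum N xs = 0\<^sub>v N \<Longrightarrow> y = vsum N ys"
    using assms(1) xs bvec_add_eq_iff[of y N "vsum N ys" "0\<^sub>v N"] by auto
  then show ?thesis using assms vsum_in_fspan[of ys N] xs by auto
qed

text \<open>The translate of the old span by x is disjoint from it, so each new vector doubles the
  size. Dimensions are handled through such cardinalities.\<close>

lemma card_fspan:
  "set xs \<subseteq> carrier_vec N \<Longrightarrow> indep N xs \<Longrightarrow> finite (fspan N xs) \<and> card (fspan N xs) = 2 ^ length xs"
proof (induction xs)
  case (Cons x xs)
  have c: "x \<in> carrier_vec N" "set xs \<subseteq> carrier_vec N" using Cons.prems by auto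
  have f: "finite (fspan N xs)" "card (fspan N xs) = 2 ^ length xs" using Cons by auto
  have eq: "fspan N (x # xs) = fspan N xs \<union> (+) x ` fspan N xs" (is "?l = ?r")
  proof
    show "?l \<subseteq> ?r"
    proof
      fix v assume v: "v \<in> ?l"
      then have "v = x + (x + v)" using c by simp
      then show "v \<in> ?r" using v by auto
    qed
    show "?r \<subseteq> ?l" using c fspan_carrier by auto
  qed
  have "inj_on ((+) x) (fspan N xs)"
    by (rule inj_on_inverseI[of _ "(+) x"]) (use c fspan_carrier in auto)
  then have "card ((+) x ` fspan N xs) = 2 ^ length xs" using f by (simp add: card_image)
  moreover have "fspan N xs \<inter> (+) x ` fspan N xs = {}"
  proof (rule ccontr)
    assume "\<not> ?thesis"
    then obtain u where u: "u \<in> fspan N xs" "x + u \<in> fspan N xs" by auto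
    then have "x \<in> fspan N xs"
      using fspan_add_iff[OF c(2) u(1), of x] c comm_add_vec[of x N u] fspan_carrier[OF u(1)] by auto
    then show False using Cons.prems by simp
  qed
  ultimately show ?case using f unfolding eq by (simp add: card_Un_disjoint)
qed simp

lemma card_carrier_bvec:
  "finite (carrier_vec N :: bit vec set)" "card (carrier_vec N :: bit vec set) \<le> 2 ^ N"
proof -
  let ?F = "PiE {..<N} (\<lambda>_. UNIV :: bit set)"
  have U: "(UNIV :: bit set) = {0, 1}" using bit.exhaust by auto
  have f: "finite ?F" unfolding U by (intro finite_PiE) auto
  have card: "card ?F = 2 ^ N" unfolding U by (simp add: card_PiE numeral_2_eq_2)
  have sub: "(carrier_vec N :: bit vec set) \<subseteq> vec N ` ?F"
  proof
    fix v :: "bit vec" assume "v \<in> carrier_vec N"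
    then show "v \<in> vec N ` ?F"
      by (intro image_eqI[of _ _ "restrict (($) v) {..<N}"]) (auto intro!: eq_vecI)
  qed
  show "finite (carrier_vec N :: bit vec set)" using sub f finite_surj by blast
  show "card (carrier_vec N :: bit vec set) \<le> 2 ^ N"
    using card_mono[OF _ sub] card_image_le[OF f, of "vec N"] f card by simp
qed

section \<open>Symmetric matrices as sums of rank-one squares\<close>

definition outer :: "bit vec \<Rightarrow> bit mat" where
  "outer x = mat (dim_vec x) (dim_vec x) (\<lambda>(i, j). x $ i * x $ j)"

text \<open>This is \<open>X * transpose_mat X\<close> for the matrix X with columns xs, not the
  matrix of pairwise scalar products.\<close>

fun gram :: "nat \<Rightarrow> bit vec list \<Rightarrow> bit mat" where
  "gram N [] = 0\<^sub>m N N"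
| "gram N (x # xs) = outer x + gram N xs"

definition diag_vec :: "bit mat \<Rightarrow> bit vec" where
  "diag_vec M = vec (dim_row M) (\<lambda>i. M $$ (i, i))"

lemma outer_carrier [simp]: "x \<in> carrier_vec N \<Longrightarrow> outer x \<in> carrier_mat N N"
  by (auto simp: outer_def)

lemma gram_carrier [simp]: "set xs \<subseteq> carrier_vec N \<Longrightarrow> gram N xs \<in> carrier_mat N N"
  by (induction xs) auto

lemma diag_vec_carrier [simp]: "M \<in> carrier_mat N N \<Longrightarrow> diag_vec M \<in> carrier_vec N"
  by (auto simp: diag_vec_def)

lemma outer_mult_vec:
  assumes "x \<in> carrier_vec N" "v \<in> carrier_vec N"
  shows "outer x *\<^sub>v v = (x \<bullet> v) \<cdot>\<^sub>v x"
  using assms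
  by (intro eq_vecI) (auto simp: outer_def scalar_prod_def sum_distrib_left sum_distrib_right ac_simps)

lemma transpose_outer: "transpose_mat (outer x) = outer x"
  by (intro eq_matI) (auto simp: outer_def mult.commute)

lemma transpose_gram: "set xs \<subseteq> carrier_vec N \<Longrightarrow> transpose_mat (gram N xs) = gram N xs"
  by (induction xs) (auto simp: transpose_outer transpose_add[of _ N N])

lemma diag_vec_outer: "diag_vec (outer x) = x"
  by (intro eq_vecI) (auto simp: diag_vec_def outer_def)

lemma diag_vec_add: "A \<in> carrier_mat N N \<Longrightarrow> B \<in> carrier_mat N N \<Longrightarrow> diag_vec (A + B) = diag_vec A + diag_vec B"
  by (intro eq_vecI) (auto simp: diag_vec_def)

lemma diag_vec_one: "diag_vec (1\<^sub>m N) = ones N"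
  by (intro eq_vecI) (auto simp: diag_vec_def)

lemma diag_vec_gram: "set xs \<subseteq> carrier_vec N \<Longrightarrow> diag_vec (gram N xs) = vsum N xs"
proof (induction xs)
  case Nil
  show ?case by (intro eq_vecI) (auto simp: diag_vec_def)
qed (auto simp: diag_vec_outer diag_vec_add[of _ N])

lemma gram_append:
  "set xs \<subseteq> carrier_vec N \<Longrightarrow> set ys \<subseteq> carrier_vec N \<Longrightarrow> gram N (xs @ ys) = gram N xs + gram N ys"
  by (induction xs) (auto simp: assoc_add_mat[of _ N N])

lemma gram_mult_vec_Cons:
  assumes "set (x # xs) \<subseteq> carrier_vec N" "v \<in> carrier_vec N"
  shows "gram N (x # xs) *\<^sub>v v = (x \<bullet> v) \<cdot>\<^sub>v x + gram N xs *\<^sub>v v"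
  using assms by (simp add: outer_mult_vec[of _ N] add_mult_distrib_mat_vec[of _ N N])

lemma gram_mult_orthogonal:
  "set xs \<subseteq> carrier_vec N \<Longrightarrow> v \<in> carrier_vec N \<Longrightarrow> \<forall>x\<in>set xs. v \<bullet> x = 0 \<Longrightarrow> gram N xs *\<^sub>v v = 0\<^sub>v N"
proof (induction xs)
  case (Cons x xs)
  then show ?case
    using comm_scalar_prod[of v N x] by (auto simp: gram_mult_vec_Cons smult_bit_vec simp del: gram.simps)
qed auto

lemma gram_mult_carrier [simp]:
  "set xs \<subseteq> carrier_vec N \<Longrightarrow> v \<in> carrier_vec N \<Longrightarrow> gram N xs *\<^sub>v v \<in> carrier_vec N"
  by (rule mult_mat_vec_carrier[OF gram_carrier])

lemma gram_mult_in_fspan: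
  "set xs \<subseteq> carrier_vec N \<Longrightarrow> v \<in> carrier_vec N \<Longrightarrow> gram N xs *\<^sub>v v \<in> fspan N xs"
proof (induction xs)
  case (Cons x xs)
  have c: "gram N xs *\<^sub>v v \<in> carrier_vec N" using Cons.prems by auto
  have "set xs \<subseteq> carrier_vec N" using Cons.prems by auto
  note IH = Cons.IH[OF this Cons.prems(2)]
  show ?case
    unfolding gram_mult_vec_Cons[OF Cons.prems] using IH Cons.prems c by (auto simp: smult_bit_vec)
qed auto

text \<open>Independence gives t with t \<bullet> x = 1 that annihilates the tail, so the matrix
  sends t to x. Values of the matrix of the tail differ from values of the full matrix by multiples
  of x.\<close>

lemma fspan_subset_range_gram:
  assumes "set xs \<subseteq> carrier_vec N" "indep N xs"
  shows "fspan N xs \<subseteq> (*\<^sub>v) (gram N xs) ` carrier_vec N"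
proof -
  define R where "R ys = (*\<^sub>v) (gram N ys) ` (carrier_vec N :: bit vec set)" for ys
  have R_add: "u + v \<in> R ys" if uv: "set ys \<subseteq> carrier_vec N" "u \<in> R ys" "v \<in> R ys" for u v ys
  proof -
    obtain s t where st: "s \<in> carrier_vec N" "t \<in> carrier_vec N" "u = gram N ys *\<^sub>v s" "v = gram N ys *\<^sub>v t"
      using uv(2,3) unfolding R_def by auto
    then have "u + v = gram N ys *\<^sub>v (s + t)" using uv(1)
      by (simp add: mult_add_distrib_mat_vec[of _ N N])
    then show ?thesis using st unfolding R_def by auto
  qed
  have "fspan N xs \<subseteq> R xs" using assms
  proof (induction xs)
    case (Cons x xs)
    have c: "x \<in> carrier_vec N" "set xs \<subseteq> carrier_vec N" using Cons.prems by auto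
    have IH: "fspan N xs \<subseteq> R xs" using Cons by auto
    obtain t where t: "t \<in> carrier_vec N" "\<forall>y\<in>set xs. t \<bullet> y = 0" "t \<bullet> x = 1"
      using fspan_separating_vec[of xs N x] Cons.prems by auto
    have "gram N (x # xs) *\<^sub>v t = x"
      unfolding gram_mult_vec_Cons[OF Cons.prems(1) t(1)]
      using gram_mult_orthogonal[OF c(2) t(1,2)] t c comm_scalar_prod[of x N t] by simp
    then have x: "x \<in> R (x # xs)" using t(1) unfolding R_def by (metis imageI)
    have 0: "0\<^sub>v N \<in> R (x # xs)" using R_add[OF Cons.prems(1) x x] c by simp
    have sub: "u \<in> R (x # xs)" if u: "u \<in> fspan N xs" for u
    proof -
      obtain w where w: "w \<in> carrier_vec N" "u = gram N xs *\<^sub>v w" using u IH unfolding R_def by auto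
      have uc: "u \<in> carrier_vec N" using u fspan_carrier by auto
      have "gram N (x # xs) *\<^sub>v w = (x \<bullet> w) \<cdot>\<^sub>v x + u"
        unfolding gram_mult_vec_Cons[OF Cons.prems(1) w(1)] using w by simp
      then have "(x \<bullet> w) \<cdot>\<^sub>v x + u \<in> R (x # xs)" using w(1) unfolding R_def by (metis imageI)
      moreover have "(x \<bullet> w) \<cdot>\<^sub>v x \<in> R (x # xs)" using x 0 c by (auto simp: smult_bit_vec)
      ultimately have "(x \<bullet> w) \<cdot>\<^sub>v x + ((x \<bullet> w) \<cdot>\<^sub>v x + u) \<in> R (x # xs)" using R_add[OF Cons.prems(1)] by blast
      then show ?thesis using c uc by simp
    qed
    show ?case
    proof
      fix v assume v: "v \<in> fspan N (x # xs)"
      then have "v \<in> fspan N xs \<or> x + v \<in> fspan N xs" "x + (x + v) = v" using c by auto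
      then show "v \<in> R (x # xs)" using sub x R_add[OF Cons.prems(1) x, of "x + v"] by auto
    qed
  next
    case Nil
    show ?case by (auto simp: R_def image_def intro!: bexI[of _ "0\<^sub>v N"])
  qed
  then show ?thesis unfolding R_def .
qed

lemma range_gram:
  assumes "set xs \<subseteq> carrier_vec N" "indep N xs"
  shows "(*\<^sub>v) (gram N xs) ` carrier_vec N = fspan N xs"
proof (rule subset_antisym)
  show "(*\<^sub>v) (gram N xs) ` carrier_vec N \<subseteq> fspan N xs"
    using gram_mult_in_fspan[OF assms(1)] by (intro image_subsetI)
qed (rule fspan_subset_range_gram[OF assms])

section \<open>Symmetric matrices and their quadratic forms in characteristic two\<close>

lemma symmetric_scalar_prod:
  assumes "M \<in> carrier_mat N N" "transpose_mat M = (M :: 'a :: comm_semiring_0 mat)" "u \<in> carrier_vec N" "v \<in> carrier_vec N"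
  shows "u \<bullet> (M *\<^sub>v v) = (M *\<^sub>v u) \<bullet> v"
  using transpose_vec_mult_scalar[OF assms(1,4,3)] assms(2) by simp

lemma sum_symmetric_bit:
  fixes f :: "nat \<Rightarrow> nat \<Rightarrow> bit"
  assumes "\<And>i j. i < N \<Longrightarrow> j < N \<Longrightarrow> f i j = f j i"
  shows "(\<Sum>i<N. \<Sum>j<N. f i j) = (\<Sum>i<N. f i i)"
  using assms
proof (induction N)
  case (Suc N)
  have "(\<Sum>i<Suc N. \<Sum>j<Suc N. f i j) =
      ((\<Sum>i<N. \<Sum>j<N. f i j) + (\<Sum>i<N. f i N)) + ((\<Sum>j<N. f N j) + f N N)"
    by (simp add: sum.distrib)
  also have "(\<Sum>j<N. f N j) = (\<Sum>i<N. f i N)" using Suc.prems by (intro sum.cong) auto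
  also have "(\<Sum>i<N. \<Sum>j<N. f i j) = (\<Sum>i<N. f i i)" using Suc by auto
  finally show ?case by (simp add: add.assoc)
qed simp

text \<open>Off-diagonal terms cancel in pairs and squares of entries are the entries, so the
  quadratic form is linear and represented by the diagonal. Hence \<open>inv_alpha\<close> tests
  whether the diagonal vanishes.\<close>

lemma quadratic_form_eq_diag:
  assumes "M \<in> carrier_mat N N" "transpose_mat M = M" "v \<in> carrier_vec N"
  shows "v \<bullet> (M *\<^sub>v v) = diag_vec M \<bullet> v"
proof -
  have s: "M $$ (i, j) = M $$ (j, i)" if "i < N" "j < N" for i j
    using assms(1,2) that by (metis carrier_matD index_transpose_mat(1))
  have "v \<bullet> (M *\<^sub>v v) = (\<Sum>i<N. \<Sum>j<N. v $ i * (M $$ (i, j) * v $ j))"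
    using assms by (simp add: scalar_prod_def sum_distrib_left atLeast0LessThan)
  also have "\<dots> = (\<Sum>i<N. v $ i * (M $$ (i, i) * v $ i))"
    by (rule sum_symmetric_bit) (simp add: s ac_simps)
  also have "\<dots> = (\<Sum>i<N. M $$ (i, i) * v $ i)"
    by (intro sum.cong refl) (metis bit_mult_self mult.commute mult.assoc)
  also have "\<dots> = diag_vec M \<bullet> v"
    using assms by (simp add: scalar_prod_def diag_vec_def atLeast0LessThan)
  finally show ?thesis .
qed

text \<open>Induction on the rank: split off \<open>y y\<^sup>T\<close> for \<open>y = M v\<close> with \<open>v \<bullet> M v = 1\<close>. The rest has diagonal
  \<open>diag_vec M + y\<close>, so \<open>v\<close> must be chosen with \<open>y \<noteq> diag_vec M\<close>; if this is impossible, \<open>M\<close> has rank one.\<close>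

lemma symmetric_eq_gram:
  assumes "M \<in> carrier_mat N N" "transpose_mat M = M" "diag_vec M \<noteq> 0\<^sub>v N"
  shows "\<exists>xs. set xs \<subseteq> (*\<^sub>v) M ` carrier_vec N \<and> indep N xs \<and> M = gram N xs"
  using assms
proof (induction "card {v \<in> carrier_vec N. M *\<^sub>v v \<noteq> 0\<^sub>v N}" arbitrary: M rule: less_induct)
  case less
  let ?d = "diag_vec M"
  note M = less.prems(1) and sym = less.prems(2)
  have d: "?d \<in> carrier_vec N" using M by simp
  have Mc: "M *\<^sub>v v \<in> carrier_vec N" if "v \<in> carrier_vec N" for v using M that by simp
  note Mdist = mult_add_distrib_mat_vec[OF M]
  obtain u where u: "u \<in> carrier_vec N" "u \<bullet> ?d = 1"
    using fspan_separating_vec[of "[]" N ?d] d less.prems(3) by auto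
  then have u: "u \<in> carrier_vec N" "?d \<bullet> u = 1" using comm_scalar_prod[OF d u(1)] by simp_all
  show ?case
  proof (cases "\<exists>v\<in>carrier_vec N. ?d \<bullet> v = 1 \<and> M *\<^sub>v v \<noteq> ?d")
    case False
    then have eq: "M *\<^sub>v v = ?d" if "v \<in> carrier_vec N" "?d \<bullet> v = 1" for v using that by blast
    \<comment> \<open>M is constant on the affine hyperplane d \<bullet> v = 1, so it kills the
      hyperplane d \<bullet> v = 0, just as \<open>outer ?d\<close> does.\<close>
    have "M = outer ?d"
    proof (rule mat_eq_mult_vecI[OF M outer_carrier[OF d]])
      fix w :: "bit vec" assume w: "w \<in> carrier_vec N"
      show "M *\<^sub>v w = outer ?d *\<^sub>v w"
      proof (cases "?d \<bullet> w" rule: bit.exhaust[case_names 0 1])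
        case 0
        then have "M *\<^sub>v (u + w) = ?d"
          using w u d by (intro eq) (auto simp: scalar_prod_add_distrib[of _ N])
        then have "?d + M *\<^sub>v w = ?d" using eq[OF u] Mdist u w by simp
        then have "M *\<^sub>v w = 0\<^sub>v N" using Mc[OF w] d bvec_add_eq_iff[of ?d N "M *\<^sub>v w" ?d] by simp
        then show ?thesis using 0 w d by (simp add: outer_mult_vec[of _ N] smult_bit_vec)
      next
        case 1
        then show ?thesis using eq w d by (simp add: outer_mult_vec[of _ N])
      qed
    qed
    then have "M = gram N [?d]" using M by simp
    moreover have "?d \<in> (*\<^sub>v) M ` carrier_vec N" using imageI[OF u(1), of "(*\<^sub>v) M"] eq[OF u] by simp
    ultimately show ?thesis using less.prems(3) by (intro exI[of _ "[?d]"]) auto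
  next
    case True
    then obtain v where v: "v \<in> carrier_vec N" "?d \<bullet> v = 1" "M *\<^sub>v v \<noteq> ?d" by auto
    define y where "y = M *\<^sub>v v"
    have y: "y \<in> carrier_vec N" using Mc v y_def by simp
    have yv: "y \<bullet> v = 1"
      using quadratic_form_eq_diag[OF M sym v(1)] v comm_scalar_prod[OF v(1) y] y_def by simp
    let ?M = "outer y + M"
    have M': "?M \<in> carrier_mat N N" using M y by simp
    have sym': "transpose_mat ?M = ?M"
      using M y sym transpose_add[of "outer y" N N M] by (simp add: transpose_outer)
    have M'v: "?M *\<^sub>v w = (y \<bullet> w) \<cdot>\<^sub>v y + M *\<^sub>v w" if "w \<in> carrier_vec N" for w
      using that y M by (simp add: add_mult_distrib_mat_vec[of _ N N] outer_mult_vec[of _ N])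
    have "diag_vec ?M = y + ?d" using y M by (simp add: diag_vec_add[of _ N] diag_vec_outer)
    then have nz: "diag_vec ?M \<noteq> 0\<^sub>v N"
      using v(3) y d bvec_add_eq_iff[of y N ?d "0\<^sub>v N"] y_def by auto
    have M'v0: "?M *\<^sub>v v = 0\<^sub>v N" using M'v[OF v(1)] yv y y_def by simp
    have range: "(*\<^sub>v) ?M ` carrier_vec N \<subseteq> (*\<^sub>v) M ` carrier_vec N"
    proof clarify
      fix w :: "bit vec" assume w: "w \<in> carrier_vec N"
      \<comment> \<open>Since y is itself M v, removing its square only corrects the argument by a
        multiple of v; the image does not grow.\<close>
      have "?M *\<^sub>v w = M *\<^sub>v ((y \<bullet> w) \<cdot>\<^sub>v v + w)"
        using w v y M unfolding M'v[OF w] by (simp add: Mdist mult_mat_vec[of _ N N] y_def)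
      then show "?M *\<^sub>v w \<in> (*\<^sub>v) M ` carrier_vec N" using w v by (intro image_eqI[of _ _ "(y \<bullet> w) \<cdot>\<^sub>v v + w"]) auto
    qed
    have ker: "?M *\<^sub>v w = 0\<^sub>v N" if "w \<in> carrier_vec N" "M *\<^sub>v w = 0\<^sub>v N" for w
    proof -
      have "y \<bullet> w = v \<bullet> (M *\<^sub>v w)"
        unfolding y_def using symmetric_scalar_prod[OF M sym v(1) that(1)] by simp
      then show ?thesis using that M'v v y by (simp add: smult_bit_vec)
    qed
    \<comment> \<open>The kernel is kept and gains v, which M sends to the nonzero y. So fewer
      vectors lie outside the kernel, and their number drives the induction.\<close>
    have "y \<noteq> 0\<^sub>v N" using yv v by auto
    then have "{v \<in> carrier_vec N. ?M *\<^sub>v v \<noteq> 0\<^sub>v N} \<subset> {v \<in> carrier_vec N. M *\<^sub>v v \<noteq> 0\<^sub>v N}"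
      using M'v0 v(1) ker unfolding y_def by blast
    then have "card {v \<in> carrier_vec N. ?M *\<^sub>v v \<noteq> 0\<^sub>v N} < card {v \<in> carrier_vec N. M *\<^sub>v v \<noteq> 0\<^sub>v N}"
      by (intro psubset_card_mono) (auto simp: card_carrier_bvec(1))
    from less.hyps[OF this M' sym' nz] obtain xs where
      xs: "set xs \<subseteq> (*\<^sub>v) ?M ` carrier_vec N" "indep N xs" "?M = gram N xs" by auto
    have xsc: "set xs \<subseteq> carrier_vec N" using xs(1) M' by auto
    have "v \<bullet> x = 0" if x: "x \<in> set xs" for x
    proof -
      obtain w where w: "w \<in> carrier_vec N" "x = ?M *\<^sub>v w" using xs x by blast
      then have "v \<bullet> x = (?M *\<^sub>v v) \<bullet> w"
        using symmetric_scalar_prod[OF M' sym' v(1), of w] by simp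
      then show ?thesis using M'v0 w by simp
    qed
    \<comment> \<open>v annihilates the image of the remainder, hence the span of xs, while y
      \<bullet> v = 1.\<close>
    then have "y \<notin> fspan N xs"
      using fspan_orthogonal[OF xsc v(1)] yv comm_scalar_prod[OF y v(1)] by fastforce
    moreover have "M = gram N (y # xs)"
      using xs(3) M y bmat_add_cancel[of "outer y" N N M] by simp
    moreover have "set (y # xs) \<subseteq> (*\<^sub>v) M ` carrier_vec N" using xs(1) range v y_def by auto
    ultimately show ?thesis using xs(2) by (intro exI[of _ "y # xs"]) auto
  qed
qed

section \<open>Rank and the orthogonal group\<close>

lemma fspan_eq_span:
  assumes "set xs \<subseteq> carrier_vec N"
  shows "fspan N xs = LinearCombinations.module.span class_ring (module_vec TYPE(bit) N) (set xs)"
proof -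
  interpret V: vec_space "TYPE(bit)" N .
  show ?thesis
  proof (rule subset_antisym)
    show "fspan N xs \<subseteq> V.span (set xs)"
      using assms V.span_add1[of "set xs"] submodule.zero_closed[OF V.span_is_submodule[of "set xs"]]
        V.span_mem[of "set xs"] V.span_closed[of "set xs"]
      by (intro fspan_subset) auto
    have "c \<cdot>\<^sub>v v \<in> fspan N xs" if "v \<in> fspan N xs" for c v
      using that fspan_carrier[OF that] by (auto simp: smult_bit_vec)
    then have "submodule class_ring (fspan N xs) V.V"
      unfolding submodule_def using assms fspan_carrier fspan_add[OF assms]
      by (auto simp: V.module_axioms)
    then show "V.span (set xs) \<subseteq> fspan N xs"
      by (rule V.span_is_subset[OF set_subset_fspan[OF assms]])
  qed
qed

lemma lin_indpt_imp_indep: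
  assumes "set xs \<subseteq> carrier_vec N" "distinct xs"
    "\<not> LinearCombinations.module.lin_dep class_ring (module_vec TYPE(bit) N) (set xs)"
  shows "indep N xs"
proof -
  interpret V: vec_space "TYPE(bit)" N .
  show ?thesis using assms
  proof (induction xs)
    case (Cons x xs)
    have c: "x \<in> carrier_vec N" "set xs \<subseteq> carrier_vec N" "x \<notin> set xs" using Cons.prems by auto
    have li: "V.lin_indpt (set xs)"
      using V.subset_li_is_li[OF Cons.prems(3), of "set xs"] by auto
    then have "x \<notin> V.span (set xs)"
      using V.lin_dep_iff_in_span[of "set xs" x] Cons.prems c by auto
    then show ?case using Cons.IH c li Cons.prems fspan_eq_span[OF c(2)] by auto
  qed simp
qed

text \<open>A maximal independent set of columns has \<open>rank\<close> many elements and spans the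
  range. From here on ranks can be compared by counting.\<close>

lemma card_range_eq_rank:
  fixes M :: "bit mat"
  assumes M: "M \<in> carrier_mat N N"
  shows "card ((*\<^sub>v) M ` carrier_vec N) = 2 ^ vec_space.rank N M"
proof -
  interpret V: vec_space "TYPE(bit)" N .
  let ?C = "set (cols M)"
  have C: "?C \<subseteq> carrier_vec N" using M cols_dim by blast
  have "V.lin_indpt {}" by (simp add: V.lin_dep_def)
  then obtain U where U: "finite U" "maximal U (\<lambda>T. T \<subseteq> ?C \<and> V.lin_indpt T)"
    using maximal_exists_superset[of ?C "\<lambda>T. T \<subseteq> ?C \<and> V.lin_indpt T" "{}"] by auto
  have Ul: "U \<subseteq> ?C" "V.lin_indpt U" using U(2) unfolding maximal_def by auto
  have Uc: "U \<subseteq> carrier_vec N" using Ul C by auto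
  have "?C \<subseteq> V.span U"
  proof
    fix c assume c: "c \<in> ?C"
    show "c \<in> V.span U"
    proof (rule ccontr)
      assume n: "c \<notin> V.span U"
      have cU: "c \<notin> U" using n V.span_mem[of U] Uc by auto
      then have "V.lin_indpt (insert c U)"
        using V.lin_dep_iff_in_span[of U c] Ul Uc c C n by auto
      then show False using U(2) c Ul cU unfolding maximal_def by blast
    qed
  qed
  then have "V.span ?C = V.span U"
    using V.span_subsetI[OF Uc] V.span_is_monotone[OF Ul(1)] by auto
  moreover have "V.span ?C = (*\<^sub>v) M ` carrier_vec N"
    using V.col_space_eq[OF M] M unfolding V.col_space_def by (auto simp: image_def)
  moreover obtain xs where xs: "set xs = U" "distinct xs" using U(1) finite_distinct_list by auto
  moreover have "indep N xs" using lin_indpt_imp_indep[of xs N] xs Uc Ul by auto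
  ultimately have "card ((*\<^sub>v) M ` carrier_vec N) = 2 ^ length xs"
    using card_fspan[of xs N] fspan_eq_span[of xs N] Uc by auto
  also have "length xs = V.rank M"
    using V.rank_card_indpt[OF M U(2)] xs distinct_card by fastforce
  finally show ?thesis .
qed

lemma rank_gram:
  assumes "set xs \<subseteq> carrier_vec N" "indep N xs"
  shows "vec_space.rank N (gram N xs) = length xs"
  using card_range_eq_rank[OF gram_carrier[OF assms(1)]] card_fspan[OF assms] range_gram[OF assms]
  by simp

section \<open>Orthogonal matrices: action on vectors and conjugation\<close>

lemma TO_E:
  assumes "P \<in> carrier (TO N)"
  shows "P \<in> carrier_mat N N" "transpose_mat P * P = 1\<^sub>m N" "P * transpose_mat P = 1\<^sub>m N"
    "transpose_mat P \<in> carrier_mat N N"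
  using assms TO_transpose_right[OF assms] by (auto simp: TO_carrier_iff)

lemma TO_transpose:
  assumes "P \<in> carrier (TO N)"
  shows "transpose_mat P \<in> carrier (TO N)"
  using TO_E[OF assms] by (simp add: TO_carrier_iff)

lemma TO_mult:
  assumes "P \<in> carrier (TO N)" "Q \<in> carrier (TO N)"
  shows "P * Q \<in> carrier (TO N)"
  using monoid.m_closed[OF group.is_monoid[OF group_TO] assms] by (simp add: TO_def)

lemma TO_one: "1\<^sub>m N \<in> carrier (TO N)"
  by (simp add: TO_carrier_iff)

lemma TO_scalar_prod:
  assumes "P \<in> carrier (TO N)" "u \<in> carrier_vec N" "v \<in> carrier_vec N"
  shows "(P *\<^sub>v u) \<bullet> (P *\<^sub>v v) = u \<bullet> v"
proof -
  note P = TO_E[OF assms(1)]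
  have "(transpose_mat (transpose_mat P) *\<^sub>v u) \<bullet> (P *\<^sub>v v) = u \<bullet> (transpose_mat P *\<^sub>v (P *\<^sub>v v))"
    using P assms by (intro transpose_vec_mult_scalar) auto
  also have "transpose_mat P *\<^sub>v (P *\<^sub>v v) = v"
    using P assms assoc_mult_mat_vec[OF P(4,1) assms(3)] by simp
  finally show ?thesis by simp
qed

lemma TO_mult_vec_cancel:
  assumes "P \<in> carrier (TO N)" "v \<in> carrier_vec N"
  shows "transpose_mat P *\<^sub>v (P *\<^sub>v v) = v" "P *\<^sub>v (transpose_mat P *\<^sub>v v) = v"
  using TO_E[OF assms(1)] assms(2)
  by (simp_all flip: assoc_mult_mat_vec[of _ N N _ N])

lemma eq_vec_scalar_prodI:
  assumes "u \<in> carrier_vec N" "v \<in> carrier_vec N" "\<And>w. w \<in> carrier_vec N \<Longrightarrow> w \<bullet> u = w \<bullet> (v :: 'a :: semiring_1 vec)"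
  shows "u = v"
proof (rule eq_vecI)
  fix i assume i: "i < dim_vec v"
  then show "u $ i = v $ i" using assms(1,2) assms(3)[of "unit_vec N i"] by simp
qed (use assms in auto)

text \<open>Pairing w with the image of \<open>ones N\<close> gives the self-product of
  \<open>transpose_mat P *\<^sub>v w\<close>, which equals that of w, which is the pairing of w with
  \<open>ones N\<close>.\<close>

lemma TO_mult_ones:
  assumes "P \<in> carrier (TO N)"
  shows "P *\<^sub>v ones N = ones N"
proof (rule eq_vec_scalar_prodI)
  note P = TO_E[OF assms]
  show "P *\<^sub>v ones N \<in> carrier_vec N" using P by simp
  fix w :: "bit vec" assume w: "w \<in> carrier_vec N"
  have tw: "transpose_mat P *\<^sub>v w \<in> carrier_vec N" using P w by simp
  have "w \<bullet> (P *\<^sub>v ones N) = (P *\<^sub>v (transpose_mat P *\<^sub>v w)) \<bullet> (P *\<^sub>v ones N)"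
    using TO_mult_vec_cancel[OF assms w] by simp
  also have "\<dots> = (transpose_mat P *\<^sub>v w) \<bullet> (transpose_mat P *\<^sub>v w)"
    using TO_scalar_prod[OF assms tw ones_carrier] scalar_prod_ones[OF tw] by simp
  also have "\<dots> = w \<bullet> w" by (rule TO_scalar_prod[OF TO_transpose[OF assms] w w])
  finally show "w \<bullet> (P *\<^sub>v ones N) = w \<bullet> ones N" using scalar_prod_ones[OF w] by simp
qed simp

lemma mult_outer:
  assumes "P \<in> carrier_mat N N" "x \<in> carrier_vec N"
  shows "P * outer x * transpose_mat P = outer (P *\<^sub>v x)"
proof (rule mat_eq_mult_vecI[of _ N N])
  fix v :: "bit vec" assume v: "v \<in> carrier_vec N"
  have "(P * outer x * transpose_mat P) *\<^sub>v v = P *\<^sub>v (outer x *\<^sub>v (transpose_mat P *\<^sub>v v))"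
    using assms v outer_carrier[OF assms(2)] 
    by (simp add: assoc_mult_mat_vec[of _ N N _ N] assoc_mult_mat_vec[of P N N "outer x" N])
  also have "\<dots> = (x \<bullet> (transpose_mat P *\<^sub>v v)) \<cdot>\<^sub>v (P *\<^sub>v x)"
    using assms v by (simp add: outer_mult_vec[of _ N] mult_mat_vec[of _ N N])
  also have "x \<bullet> (transpose_mat P *\<^sub>v v) = (P *\<^sub>v x) \<bullet> v"
    using transpose_vec_mult_scalar[of "transpose_mat P" N N v x] assms v by simp
  finally show "(P * outer x * transpose_mat P) *\<^sub>v v = outer (P *\<^sub>v x) *\<^sub>v v"
    using assms v by (simp add: outer_mult_vec[of _ N])
qed (use assms outer_carrier in auto)

lemma conj_add:
  assumes "P \<in> carrier_mat N N" "A \<in> carrier_mat N N" "B \<in> carrier_mat N (N :: nat)"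
  shows "P * (A + B) * transpose_mat P = P * A * transpose_mat P + P * B * transpose_mat (P :: bit mat)"
  using assms by (simp add: mult_add_distrib_mat[of _ N N _ N] add_mult_distrib_mat[of _ N N _ _ N])

text \<open>Conjugation moves the square of each x to that of its image. Conjugating two involutions
  thus reduces to carrying one list of vectors to another.\<close>

lemma mult_gram:
  assumes "P \<in> carrier_mat N N"
  shows "set xs \<subseteq> carrier_vec N \<Longrightarrow> P * gram N xs * transpose_mat P = gram N (map ((*\<^sub>v) P) xs)"
proof (induction xs)
  case (Cons x xs)
  then show ?case using assms by (simp add: conj_add[of _ N] mult_outer[of _ N])
qed (use assms in simp)

section \<open>Transvections and Witt extension\<close>

lemma transvection:
  assumes "u \<in> carrier_vec N" "u \<bullet> u = 0"
  shows "1\<^sub>m N + outer u \<in> carrier (TO N)"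
    "\<And>v. v \<in> carrier_vec N \<Longrightarrow> (1\<^sub>m N + outer u) *\<^sub>v v = v + (u \<bullet> v) \<cdot>\<^sub>v u"
proof -
  let ?T = "1\<^sub>m N + outer u"
  have T: "?T \<in> carrier_mat N N" using assms by simp
  show Tv: "?T *\<^sub>v v = v + (u \<bullet> v) \<cdot>\<^sub>v u" if "v \<in> carrier_vec N" for v
    using assms that by (simp add: add_mult_distrib_mat_vec[of _ N N] outer_mult_vec[of _ N])
  \<comment> \<open>As u \<bullet> u = 0, applying the map twice adds the same multiple of u twice.
    A symmetric matrix of square one is orthogonal.\<close>
  have "?T * ?T = 1\<^sub>m N"
  proof (rule mat_eq_mult_vecI[of _ N N])
    fix v :: "bit vec" assume v: "v \<in> carrier_vec N"
    have w: "v + (u \<bullet> v) \<cdot>\<^sub>v u \<in> carrier_vec N" using v assms by simp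
    have "?T * ?T *\<^sub>v v = ?T *\<^sub>v (v + (u \<bullet> v) \<cdot>\<^sub>v u)"
      using assoc_mult_mat_vec[OF T T v] Tv[OF v] by simp
    also have "\<dots> = v"
      unfolding Tv[OF w] using v assms
      by (auto simp: smult_bit_vec scalar_prod_add_distrib[of _ N] intro!: eq_vecI)
    finally show "?T * ?T *\<^sub>v v = 1\<^sub>m N *\<^sub>v v" using v by simp
  qed (use T in auto)
  moreover have "transpose_mat ?T = ?T"
    using assms transpose_add[of "1\<^sub>m N" N N "outer u"] by (simp add: transpose_outer)
  ultimately show "?T \<in> carrier (TO N)" using T by (simp add: TO_carrier_iff)
qed

text \<open>The vector x + y is isotropic because x and y have equal self-products, it is orthogonal
  to zs, and it pairs to 1 with x; so its transvection sends x to x + (x + y) = y.\<close>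

lemma transvection_step:
  assumes "set zs \<subseteq> carrier_vec N" "x \<in> carrier_vec N" "y \<in> carrier_vec N"
    and "\<forall>z\<in>set zs. x \<bullet> z = y \<bullet> z" "x \<bullet> x = y \<bullet> y" "x \<bullet> x \<noteq> x \<bullet> y"
  shows "\<exists>P\<in>carrier (TO N). P *\<^sub>v x = y \<and> (\<forall>z\<in>set zs. P *\<^sub>v z = z)"
proof -
  let ?u = "x + y"
  have u: "?u \<in> carrier_vec N" using assms by simp
  have e: "?u \<bullet> v = x \<bullet> v + y \<bullet> v" if "v \<in> carrier_vec N" for v
    using that assms by (simp add: add_scalar_prod_distrib[of _ N])
  have c: "y \<bullet> x = x \<bullet> y" using assms comm_scalar_prod by blast
  have uu: "?u \<bullet> ?u = 0" using assms by (simp add: e scalar_prod_add_distrib[of _ N] c)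
  have ux: "?u \<bullet> x = 1" using assms(6) by (simp add: e assms c) (metis bit_add_eq_0_iff bit_not_one_iff)
  note T = transvection[OF u uu]
  have "(1\<^sub>m N + outer ?u) *\<^sub>v x = y" using T(2)[of x] ux assms by simp
  moreover have "(1\<^sub>m N + outer ?u) *\<^sub>v z = z" if "z \<in> set zs" for z
    using that T(2)[of z] assms e[of z] by (auto simp: smult_bit_vec)
  ultimately show ?thesis using T(1) by blast
qed

text \<open>The transvection along \<open>x + y\<close> sends \<open>x\<close> to \<open>y\<close> only if \<open>x \<bullet> x \<noteq> x \<bullet> y\<close>; otherwise two transvections
  through a suitable intermediate vector are needed.\<close>

lemma TO_move:
  assumes zs: "set zs \<subseteq> carrier_vec N" and x: "x \<in> carrier_vec N" and y: "y \<in> carrier_vec N"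
    and eqs: "\<forall>z\<in>set zs. x \<bullet> z = y \<bullet> z" "x \<bullet> x = y \<bullet> y"
    and nx: "x \<notin> fspan N (ones N # zs)" and ny: "y \<notin> fspan N (ones N # zs)"
  shows "\<exists>P\<in>carrier (TO N). P *\<^sub>v x = y \<and> (\<forall>z\<in>set zs. P *\<^sub>v z = z)"
proof (cases "x \<bullet> x = x \<bullet> y")
  case False
  then show ?thesis using transvection_step assms by blast
next
  case True
  have zs': "set (ones N # zs) \<subseteq> carrier_vec N" using zs by simp
  \<comment> \<open>The intermediate vector is x + t. Orthogonality to \<open>ones N\<close> means t
    \<bullet> t = 0, so the self-product of x is kept; orthogonality to zs keeps the pairings; t
    \<bullet> x = t \<bullet> y = 1 makes both transvections admissible. The avoided span is exactly
    what provides t.\<close>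
  obtain t where t: "t \<in> carrier_vec N" "\<forall>z\<in>set (ones N # zs). t \<bullet> z = 0" "t \<bullet> x = 1" "t \<bullet> y = 1"
    using fspan_separating_vec2[OF zs' x nx y ny] by blast
  let ?z = "x + t"
  have z: "?z \<in> carrier_vec N" using x t by simp
  have tt: "t \<bullet> t = 0" using t scalar_prod_ones[OF t(1)] by simp
  have sym: "x \<bullet> t = 1" "y \<bullet> t = 1" "y \<bullet> x = x \<bullet> y"
    using t x y comm_scalar_prod[of t N x] comm_scalar_prod[of t N y] comm_scalar_prod[of y N x] by auto
  have el: "?z \<bullet> w = x \<bullet> w + t \<bullet> w" "w \<bullet> ?z = w \<bullet> x + w \<bullet> t" if "w \<in> carrier_vec N" for w
    using that x t by (simp_all add: add_scalar_prod_distrib[of _ N] scalar_prod_add_distrib[of _ N])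
  have zz: "?z \<bullet> ?z = x \<bullet> x" using z x t sym tt by (simp add: el)
  have 1: "\<forall>w\<in>set zs. x \<bullet> w = ?z \<bullet> w" using t zs by (auto simp: el subset_iff)
  have 2: "x \<bullet> x \<noteq> x \<bullet> ?z" using x sym by (simp add: el)
  have 3: "?z \<bullet> ?z \<noteq> ?z \<bullet> y" using y t zz True by (simp add: el)
  obtain P where P: "P \<in> carrier (TO N)" "P *\<^sub>v x = ?z" "\<forall>w\<in>set zs. P *\<^sub>v w = w"
    using transvection_step[OF zs x z 1 zz[symmetric] 2] by blast
  obtain Q where Q: "Q \<in> carrier (TO N)" "Q *\<^sub>v ?z = y" "\<forall>w\<in>set zs. Q *\<^sub>v w = w"
    using transvection_step[OF zs z y _ _ 3] 1 eqs zz by auto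
  have "(Q * P) *\<^sub>v v = Q *\<^sub>v (P *\<^sub>v v)" if "v \<in> carrier_vec N" for v
    using that P(1) Q(1) TO_E(1) assoc_mult_mat_vec by blast
  then show ?thesis using P Q TO_mult[OF Q(1) P(1)] x zs by (intro bexI[of _ "Q * P"]) (auto simp: subset_iff)
qed

definition totally_isotropic :: "bit vec list \<Rightarrow> bool" where
  "totally_isotropic xs \<longleftrightarrow> (\<forall>x\<in>set xs. \<forall>y\<in>set xs. x \<bullet> y = 0)"

lemma mult_vec_in_fspan_iff:
  assumes P: "P \<in> carrier (TO N)"
  shows "set xs \<subseteq> carrier_vec N \<Longrightarrow> v \<in> carrier_vec N \<Longrightarrow> P *\<^sub>v v \<in> fspan N (map ((*\<^sub>v) P) xs) \<longleftrightarrow> v \<in> fspan N xs"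
proof (induction xs arbitrary: v)
  case Nil
  have "P *\<^sub>v 0\<^sub>v N = 0\<^sub>v N" using TO_E(1)[OF P] by (intro eq_vecI) auto
  then show ?case using Nil TO_mult_vec_cancel(1)[OF P, of v] TO_mult_vec_cancel(1)[OF P, of "0\<^sub>v N"] by auto
next
  case (Cons x xs)
  have "P *\<^sub>v x + P *\<^sub>v v = P *\<^sub>v (x + v)"
    using Cons.prems TO_E(1)[OF P] by (simp add: mult_add_distrib_mat_vec[of _ N N])
  then show ?case using Cons TO_E(1)[OF P] by simp
qed

text \<open>The tails are matched by induction; \<open>TO_move\<close> then takes the image of x to
  y and fixes ys. That both avoid the span of \<open>ones N\<close> and ys combines independence
  with \<open>ones N\<close> being outside the spans of the full lists.\<close>

lemma witt:
  assumes "length xs = length ys" "set xs \<subseteq> carrier_vec N" "set ys \<subseteq> carrier_vec N"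
    "indep N xs" "indep N ys" "totally_isotropic xs" "totally_isotropic ys"
    "ones N \<notin> fspan N xs" "ones N \<notin> fspan N ys"
  shows "\<exists>P\<in>carrier (TO N). map ((*\<^sub>v) P) xs = ys"
  using assms
proof (induction xs ys rule: list_induct2)
  case Nil
  show ?case using TO_one by auto
next
  case (Cons x xs y ys)
  have c: "x \<in> carrier_vec N" "y \<in> carrier_vec N" "set xs \<subseteq> carrier_vec N" "set ys \<subseteq> carrier_vec N"
    using Cons.prems by auto
  obtain P where P: "P \<in> carrier (TO N)" "map ((*\<^sub>v) P) xs = ys"
    using Cons fspan_mono_Cons by (auto simp: totally_isotropic_def)
  note P' = TO_E[OF P(1)]
  let ?x = "P *\<^sub>v x"
  have x: "?x \<in> carrier_vec N" using P' c by simp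
  have nx: "?x \<notin> fspan N ys" "ones N + ?x \<notin> fspan N ys"
  proof -
    show "?x \<notin> fspan N ys" using mult_vec_in_fspan_iff[OF P(1) c(3,1)] P(2) Cons.prems by simp
    have "ones N + ?x = P *\<^sub>v (ones N + x)"
      using P' c by (simp add: mult_add_distrib_mat_vec[of _ N N] TO_mult_ones[OF P(1)])
    moreover have "ones N + x = x + ones N" using c comm_add_vec ones_carrier by blast
    ultimately show "ones N + ?x \<notin> fspan N ys"
      using mult_vec_in_fspan_iff[OF P(1) c(3), of "ones N + x"] P(2) Cons.prems c by auto
  qed
  have ny: "y \<notin> fspan N (ones N # ys)"
    using Cons.prems c comm_add_vec[of y N "ones N"] by auto
  have xy: "\<forall>z\<in>set ys. ?x \<bullet> z = y \<bullet> z" "?x \<bullet> ?x = y \<bullet> y"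
    using Cons.prems c P(2) TO_scalar_prod[OF P(1)]
    by (auto simp: totally_isotropic_def subset_iff)
  obtain Q where Q: "Q \<in> carrier (TO N)" "Q *\<^sub>v ?x = y" "\<forall>z\<in>set ys. Q *\<^sub>v z = z"
    using TO_move[OF c(4) x c(2) xy _ ny] nx by auto
  note Q' = TO_E[OF Q(1)]
  have QP: "(Q * P) *\<^sub>v v = Q *\<^sub>v (P *\<^sub>v v)" if "v \<in> carrier_vec N" for v
    using that P' Q' assoc_mult_mat_vec by blast
  have "map ((*\<^sub>v) (Q * P)) xs = map ((*\<^sub>v) Q) (map ((*\<^sub>v) P) xs)"
    using QP c(3) by (auto simp: subset_iff)
  also have "\<dots> = ys" unfolding P(2) using Q(3) by (simp add: map_idI)
  finally have "map ((*\<^sub>v) (Q * P)) (x # xs) = y # ys" using QP[OF c(1)] Q(2) by simp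
  then show ?case by (intro bexI[OF _ TO_mult[OF Q(1) P(1)]])
qed

section \<open>Involutions, mirrors and conjugacy\<close>

definition iso_decomp :: "nat \<Rightarrow> bit mat \<Rightarrow> bit vec list \<Rightarrow> bool" where
  "iso_decomp N A xs \<longleftrightarrow> set xs \<subseteq> carrier_vec N \<and> indep N xs \<and> totally_isotropic xs \<and> A = 1\<^sub>m N + gram N xs"

lemma iso_decompD:
  assumes "iso_decomp N A xs"
  shows "set xs \<subseteq> carrier_vec N" "indep N xs" "totally_isotropic xs" "A = 1\<^sub>m N + gram N xs"
    "A \<in> carrier_mat N N" "A + 1\<^sub>m N = gram N xs" "transpose_mat A = A"
proof -
  show 1: "set xs \<subseteq> carrier_vec N" "indep N xs" "totally_isotropic xs" and A: "A = 1\<^sub>m N + gram N xs"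
    using assms by (auto simp: iso_decomp_def)
  note G = gram_carrier[OF 1(1)]
  show A': "A \<in> carrier_mat N N" using A G by simp
  show "A + 1\<^sub>m N = gram N xs" using A G by (intro eq_matI) (auto simp: add.assoc add.commute)
  show "transpose_mat A = A"
    unfolding A using G transpose_add[of "1\<^sub>m N" N N "gram N xs"] transpose_gram[OF 1(1)] by simp
qed

lemma inv_D_iso_decomp:
  assumes "iso_decomp N A xs"
  shows "inv_D A = length xs"
proof -
  note A = iso_decompD[OF assms]
  have "dim_row A = N" using A(5) by simp
  then show ?thesis using A(6) rank_gram[OF A(1,2)] by (simp add: inv_D_def)
qed

lemma inv_alpha_symmetric:
  assumes "A \<in> carrier_mat N N" "transpose_mat A = A"
  shows "inv_alpha A = (if diag_vec A = 0\<^sub>v N then 0 else 1)"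
proof (cases "diag_vec A = 0\<^sub>v N")
  case True
  then show ?thesis using assms quadratic_form_eq_diag[OF assms] by (simp add: inv_alpha_eq)
next
  case False
  have d: "diag_vec A \<in> carrier_vec N" using assms by simp
  obtain t where t: "t \<in> carrier_vec N" "t \<bullet> diag_vec A = 1"
    using fspan_separating_vec[of "[]" N "diag_vec A"] False d by auto
  then have "t \<bullet> (A *\<^sub>v t) = 1"
    using quadratic_form_eq_diag[OF assms t(1)] comm_scalar_prod[OF d t(1)] by simp
  then show ?thesis using assms t False by (auto simp: inv_alpha_eq)
qed

lemma diag_iso_decomp:
  assumes "iso_decomp N A xs"
  shows "diag_vec A = ones N + vsum N xs"
  using iso_decompD(1,4)[OF assms] by (simp add: diag_vec_add[of _ N] diag_vec_one diag_vec_gram)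

section \<open>Mirrors as sums with the all-ones matrix\<close>

lemma mirror_eq: "A \<in> carrier_mat N N \<Longrightarrow> mirror A = outer (ones N) + A"
  by (intro eq_matI) (auto simp: mirror_def outer_def add.commute)

lemma mirror_carrier [simp]: "A \<in> carrier_mat m n \<Longrightarrow> mirror A \<in> carrier_mat m n"
  by (simp add: mirror_def)

lemma mirror_mirror [simp]: "mirror (mirror A) = A"
  by (intro eq_matI) (auto simp: mirror_def add.assoc)

lemma diag_mirror: "A \<in> carrier_mat N N \<Longrightarrow> diag_vec (mirror A) = ones N + diag_vec A"
  by (simp add: mirror_eq[of _ N] diag_vec_add[of _ N] diag_vec_outer)

lemma transpose_mirror: "transpose_mat (mirror A) = mirror (transpose_mat A)"
  by (intro eq_matI) (auto simp: mirror_def)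

text \<open>The mirror adds the square of \<open>ones N\<close>, so that vector joins the list. It
  is self-orthogonal because N is even, and orthogonal to each x because
  \<open>x \<bullet> ones N = x \<bullet> x\<close>.\<close>

lemma iso_decomp_mirror:
  assumes "iso_decomp N A xs" "even N" "ones N \<notin> fspan N xs"
  shows "iso_decomp N (mirror A) (ones N # xs)"
proof -
  note A = iso_decompD[OF assms(1)]
  have "x \<bullet> ones N = 0" "ones N \<bullet> x = 0" if "x \<in> set xs" for x
  proof -
    have x: "x \<in> carrier_vec N" using that A by auto
    show "x \<bullet> ones N = 0" using scalar_prod_ones[OF x] A(3) that by (auto simp: totally_isotropic_def)
    then show "ones N \<bullet> x = 0" using comm_scalar_prod[OF x ones_carrier] by simp
  qed
  moreover have "ones N \<bullet> ones N = 0" using assms(2) by (simp add: ones_scalar_prod_ones of_nat_bit)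
  ultimately have "totally_isotropic (ones N # xs)" using A(3) by (auto simp: totally_isotropic_def)
  moreover have "mirror A = 1\<^sub>m N + gram N (ones N # xs)"
    unfolding mirror_eq[OF A(5)] gram.simps unfolding A(4)
    using A(1) by (intro eq_matI) (auto simp: outer_def ac_simps)
  ultimately show ?thesis using A assms(3) by (simp add: iso_decomp_def)
qed

lemma involutionsD:
  assumes "A \<in> involutions N"
  shows "A \<in> carrier (TO N)" "A \<in> carrier_mat N N" "A * A = 1\<^sub>m N" "transpose_mat A = A"
proof -
  show A: "A \<in> carrier (TO N)" "A * A = 1\<^sub>m N" using assms by (auto simp: involutions_def)
  note A' = TO_E[OF A(1)]
  show "A \<in> carrier_mat N N" by fact
  have "transpose_mat A = transpose_mat A * (A * A)" using A A' by simp
  also have "\<dots> = transpose_mat A * A * A"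
    using A' by (intro assoc_mult_mat[symmetric, of _ N N _ N _ N]) auto
  also have "\<dots> = A" using A' by simp
  finally show "transpose_mat A = A" .
qed

lemma involutionsI:
  assumes "A \<in> carrier_mat N N" "transpose_mat A = A" "A * A = 1\<^sub>m N"
  shows "A \<in> involutions N"
  using assms by (simp add: involutions_def TO_carrier_iff)

text \<open>Total isotropy makes the square of G = \<open>gram N xs\<close> vanish, and the cross
  terms of (1 + G)(1 + G) cancel.\<close>

lemma iso_decomp_involution:
  assumes "iso_decomp N A xs"
  shows "A \<in> involutions N"
proof (rule involutionsI)
  note A = iso_decompD[OF assms]
  show "A \<in> carrier_mat N N" "transpose_mat A = A" by fact+
  have Av: "A *\<^sub>v v = v + gram N xs *\<^sub>v v" if "v \<in> carrier_vec N" for v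
    unfolding A(4) using that A(1) by (simp add: add_mult_distrib_mat_vec[of _ N N])
  show "A * A = 1\<^sub>m N"
  proof (rule mat_eq_mult_vecI[of _ N N])
    fix v :: "bit vec" assume v: "v \<in> carrier_vec N"
    let ?g = "gram N xs *\<^sub>v v"
    have g: "?g \<in> fspan N xs" "?g \<in> carrier_vec N" using gram_mult_in_fspan[OF A(1) v] A(1) v by auto
    have "?g \<bullet> x = 0" if "x \<in> set xs" for x
    proof -
      have x: "x \<in> carrier_vec N" using that A(1) by auto
      have "x \<bullet> ?g = 0"
        using fspan_orthogonal[OF A(1) x _ g(1)] A(3) that by (auto simp: totally_isotropic_def)
      then show ?thesis using comm_scalar_prod[OF x g(2)] by simp
    qed
    then have gg: "gram N xs *\<^sub>v ?g = 0\<^sub>v N" using gram_mult_orthogonal[OF A(1) g(2)] by blast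
    have "A * A *\<^sub>v v = (v + ?g) + (gram N xs *\<^sub>v v + gram N xs *\<^sub>v ?g)"
      using v g A(1) assoc_mult_mat_vec[OF A(5,5) v]
      by (simp add: Av mult_add_distrib_mat_vec[of _ N N])
    also have "\<dots> = v" using gg v g by (intro eq_vecI) (auto simp: add.assoc)
    finally show "A * A *\<^sub>v v = 1\<^sub>m N *\<^sub>v v" using v by simp
  qed (use A(5) in auto)
qed

text \<open>Let E be the all-ones matrix. A fixes \<open>ones N\<close> and is symmetric, so A E = E
  A = E, and E E = 0 for even N; hence (A + E)(A + E) = A A.\<close>

lemma mirror_involution:
  assumes "A \<in> involutions N" "even N"
  shows "mirror A \<in> involutions N"
proof (rule involutionsI)
  note A = involutionsD[OF assms(1)]
  show m: "mirror A \<in> carrier_mat N N" "transpose_mat (mirror A) = mirror A"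
    using A by (auto simp: transpose_mirror)
  have mv: "mirror A *\<^sub>v v = (ones N \<bullet> v) \<cdot>\<^sub>v ones N + A *\<^sub>v v" if "v \<in> carrier_vec N" for v
    using that A by (simp add: mirror_eq[of _ N] add_mult_distrib_mat_vec[of _ N N] outer_mult_vec[of _ N])
  have o: "A *\<^sub>v ones N = ones N" by (rule TO_mult_ones[OF A(1)])
  have oo: "ones N \<bullet> ones N = 0" using assms(2) by (simp add: ones_scalar_prod_ones of_nat_bit)
  show "mirror A * mirror A = 1\<^sub>m N"
  proof (rule mat_eq_mult_vecI[of _ N N])
    fix v :: "bit vec" assume v: "v \<in> carrier_vec N"
    let ?c = "ones N \<bullet> v"
    have Av: "A *\<^sub>v v \<in> carrier_vec N" using A v by simp
    have AAv: "A *\<^sub>v (A *\<^sub>v v) = v" using A v assoc_mult_mat_vec[OF A(2,2) v] by simp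
    have oA: "ones N \<bullet> (A *\<^sub>v v) = ?c"
      using symmetric_scalar_prod[OF A(2,4) ones_carrier v] o by simp
    have w: "?c \<cdot>\<^sub>v ones N + A *\<^sub>v v \<in> carrier_vec N" using Av by simp
    have "mirror A * mirror A *\<^sub>v v = mirror A *\<^sub>v (?c \<cdot>\<^sub>v ones N + A *\<^sub>v v)"
      using assoc_mult_mat_vec[OF m(1) m(1) v] mv[OF v] by simp
    also have "\<dots> = ?c \<cdot>\<^sub>v ones N + (?c \<cdot>\<^sub>v ones N + v)"
      unfolding mv[OF w] using Av v A o oo oA AAv
      by (simp add: scalar_prod_add_distrib[of _ N] mult_add_distrib_mat_vec[of _ N N] mult_mat_vec[of _ N N])
    also have "\<dots> = v" using v by (intro bvec_add_cancel) auto
    finally show "mirror A * mirror A *\<^sub>v v = 1\<^sub>m N *\<^sub>v v" using v by simp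
  qed (use m in auto)
qed

section \<open>Conjugacy classes and invariance of \<open>DD\<close>\<close>

lemma conj_class_eqI:
  assumes A: "A \<in> carrier (TO N)" and P: "P \<in> carrier (TO N)" and B: "B = P * A * transpose_mat P"
  shows "conj_class (TO N) A = conj_class (TO N) B"
proof -
  note A' = TO_E[OF A] and P' = TO_E[OF P]
  have BT: "B \<in> carrier (TO N)" unfolding B by (intro TO_mult TO_transpose A P)
  have conj_conj: "Q * (R * C * transpose_mat R) * transpose_mat Q = (Q * R) * C * transpose_mat (Q * R)"
    if "Q \<in> carrier_mat N N" "R \<in> carrier_mat N N" "C \<in> carrier_mat N N" for Q R C :: "bit mat"
    using that by (simp add: transpose_mult[of _ N N _ N] assoc_mult_mat[of _ N N _ N _ N])
  have A_eq: "A = transpose_mat P * B * transpose_mat (transpose_mat P)"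
    unfolding B using A' P' by (subst conj_conj) simp_all
  have sub: "conj_class (TO N) C \<subseteq> conj_class (TO N) D"
    if C: "C \<in> carrier (TO N)" and D: "D \<in> carrier (TO N)" and Q: "Q \<in> carrier (TO N)"
      and eq: "C = Q * D * transpose_mat Q" for C D Q
  proof -
    have "R * C * transpose_mat R \<in> {P * D * transpose_mat P |P. P \<in> carrier (TO N)}"
      if R: "R \<in> carrier (TO N)" for R
      unfolding eq conj_conj[OF TO_E(1)[OF R] TO_E(1)[OF Q] TO_E(1)[OF D]]
      using TO_mult[OF R Q] by blast
    then show ?thesis unfolding conj_class_TO[OF C] conj_class_TO[OF D] by blast
  qed
  show ?thesis
    using sub[OF A BT TO_transpose[OF P] A_eq] sub[OF BT A P B] by simp
qed

lemma conj_class_eqD: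
  assumes A: "A \<in> carrier (TO N)" and B: "B \<in> carrier (TO N)" and eq: "conj_class (TO N) A = conj_class (TO N) B"
  shows "\<exists>P\<in>carrier (TO N). B = P * A * transpose_mat P"
proof -
  have "B = 1\<^sub>m N * B * transpose_mat (1\<^sub>m N)" using TO_E(1)[OF B] by simp
  then have "B \<in> conj_class (TO N) B" unfolding conj_class_TO[OF B] using TO_one by blast
  then show ?thesis unfolding eq[symmetric] conj_class_TO[OF A] by blast
qed

lemma inv_D_conj:
  assumes P: "P \<in> carrier (TO N)" and A: "A \<in> carrier_mat N N"
  shows "inv_D (P * A * transpose_mat P) = inv_D A"
proof -
  note P' = TO_E[OF P]
  let ?B = "P * A * transpose_mat P" and ?M = "A + 1\<^sub>m N"
  have M: "?M \<in> carrier_mat N N" using A by simp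
  have B: "?B + 1\<^sub>m N = P * ?M * transpose_mat P"
    using conj_add[OF P'(1) A, of "1\<^sub>m N"] P' by simp
  have Bv: "P * ?M * transpose_mat P *\<^sub>v v = P *\<^sub>v (?M *\<^sub>v (transpose_mat P *\<^sub>v v))" if "v \<in> carrier_vec N" for v
    using that P' M assoc_mult_mat_vec[of "P * ?M" N N "transpose_mat P" N v]
      assoc_mult_mat_vec[of P N N ?M N "transpose_mat P *\<^sub>v v"] by simp
  have range: "(*\<^sub>v) (P * ?M * transpose_mat P) ` carrier_vec N = (*\<^sub>v) P ` (*\<^sub>v) ?M ` carrier_vec N" (is "?l = ?r")
  proof (rule subset_antisym)
    show "?l \<subseteq> ?r" using Bv P' by auto
    show "?r \<subseteq> ?l"
    proof clarify
      fix v :: "bit vec" assume v: "v \<in> carrier_vec N"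
      have "P * ?M * transpose_mat P *\<^sub>v (P *\<^sub>v v) = P *\<^sub>v (?M *\<^sub>v v)"
        using Bv[of "P *\<^sub>v v"] P' v TO_mult_vec_cancel(1)[OF P v] by simp
      then show "P *\<^sub>v (?M *\<^sub>v v) \<in> ?l" using P' v by (intro image_eqI[of _ _ "P *\<^sub>v v"]) auto
    qed
  qed
  have "inj_on ((*\<^sub>v) P) ((*\<^sub>v) ?M ` carrier_vec N)"
    by (rule inj_on_inverseI[of _ "(*\<^sub>v) (transpose_mat P)"]) (use TO_mult_vec_cancel(1)[OF P mult_mat_vec_carrier[OF M]] in auto)
  then have "card ((*\<^sub>v) (?B + 1\<^sub>m N) ` carrier_vec N) = card ((*\<^sub>v) ?M ` carrier_vec N)"
    unfolding B range by (rule card_image)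
  moreover have "?B + 1\<^sub>m N \<in> carrier_mat N N" using P' A by simp
  ultimately have "(2::nat) ^ vec_space.rank N (?B + 1\<^sub>m N) = 2 ^ vec_space.rank N ?M"
    using card_range_eq_rank M by metis
  then show ?thesis using P' A by (simp add: inv_D_def)
qed

lemma inv_alpha_conj:
  assumes P: "P \<in> carrier (TO N)" and A: "A \<in> carrier_mat N N"
  shows "inv_alpha (P * A * transpose_mat P) = inv_alpha A"
proof -
  note P' = TO_E[OF P]
  let ?B = "P * A * transpose_mat P" and ?t = "(*\<^sub>v) (transpose_mat P) :: bit vec \<Rightarrow> bit vec"
  have q: "v \<bullet> (?B *\<^sub>v v) = ?t v \<bullet> (A *\<^sub>v ?t v)" if v: "v \<in> carrier_vec N" for v
  proof -
    have tv: "?t v \<in> carrier_vec N" and Atv: "A *\<^sub>v ?t v \<in> carrier_vec N" using v P' A by auto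
    have "?B *\<^sub>v v = P *\<^sub>v (A *\<^sub>v ?t v)"
      using v P' A tv assoc_mult_mat_vec[of "P * A" N N "transpose_mat P" N v]
        assoc_mult_mat_vec[of P N N A N "?t v"] by simp
    then show ?thesis
      using TO_scalar_prod[OF TO_transpose[OF P] v, of "P *\<^sub>v (A *\<^sub>v ?t v)"]
        TO_mult_vec_cancel(1)[OF P Atv] Atv P' by simp
  qed
  have "(\<exists>v\<in>carrier_vec N. v \<bullet> (?B *\<^sub>v v) = 1) \<longleftrightarrow> (\<exists>v\<in>carrier_vec N. v \<bullet> (A *\<^sub>v v) = 1)"
  proof
    assume "\<exists>v\<in>carrier_vec N. v \<bullet> (?B *\<^sub>v v) = 1"
    then show "\<exists>v\<in>carrier_vec N. v \<bullet> (A *\<^sub>v v) = 1"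
      using q P'(4) mult_mat_vec_carrier by metis
  next
    assume "\<exists>v\<in>carrier_vec N. v \<bullet> (A *\<^sub>v v) = 1"
    then obtain v where v: "v \<in> carrier_vec N" "v \<bullet> (A *\<^sub>v v) = 1" by auto
    then have "(P *\<^sub>v v) \<bullet> (?B *\<^sub>v (P *\<^sub>v v)) = 1"
      using q[of "P *\<^sub>v v"] P' TO_mult_vec_cancel(1)[OF P v(1)] by simp
    then show "\<exists>v\<in>carrier_vec N. v \<bullet> (?B *\<^sub>v v) = 1" using v P' by (intro bexI[of _ "P *\<^sub>v v"]) auto
  qed
  then show ?thesis using P' A by (simp add: inv_alpha_eq)
qed

text \<open>P fixes \<open>ones N\<close>, so conjugation fixes the all-ones matrix, the difference
  between A and its mirror.\<close>

lemma mirror_conj: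
  assumes P: "P \<in> carrier (TO N)" and A: "A \<in> carrier_mat N N"
  shows "P * mirror A * transpose_mat P = mirror (P * A * transpose_mat P)"
proof -
  note P' = TO_E[OF P]
  have B: "P * A * transpose_mat P \<in> carrier_mat N N" using P' A by simp
  show ?thesis
    unfolding mirror_eq[OF A] mirror_eq[OF B] conj_add[OF P'(1) outer_carrier[OF ones_carrier] A]
      mult_outer[OF P'(1) ones_carrier] TO_mult_ones[OF P] by (rule refl)
qed

lemma DD_conj:
  assumes "P \<in> carrier (TO N)" "A \<in> carrier_mat N N"
  shows "DD (P * A * transpose_mat P) = DD A"
  unfolding DD_def mirror_conj[OF assms, symmetric] inv_D_conj[OF assms] inv_alpha_conj[OF assms]
    inv_D_conj[OF assms(1) mirror_carrier[OF assms(2)]] inv_alpha_conj[OF assms(1) mirror_carrier[OF assms(2)]]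
  by (rule refl)

section \<open>Types of involutions\<close>

lemma card_orthogonal_complement:
  assumes "set xs \<subseteq> carrier_vec N" "indep N xs"
  shows "card {v \<in> carrier_vec N. \<forall>x\<in>set xs. v \<bullet> x = (0 :: bit)} * 2 ^ length xs \<le> 2 ^ N"
  using assms
proof (induction xs)
  case Nil
  then show ?case using card_carrier_bvec(2)[of N] by simp
next
  case (Cons x xs)
  let ?K = "\<lambda>xs. {v \<in> carrier_vec N. \<forall>x\<in>set xs. v \<bullet> x = (0 :: bit)}"
  have c: "x \<in> carrier_vec N" "set xs \<subseteq> carrier_vec N" using Cons.prems by auto
  have fin: "finite (?K ys)" for ys
    by (rule finite_subset[OF _ card_carrier_bvec(1)[of N]]) auto
  obtain t where t: "t \<in> carrier_vec N" "\<forall>y\<in>set xs. t \<bullet> y = 0" "t \<bullet> x = 1"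
    using fspan_separating_vec[of xs N x] Cons.prems by auto
  have e: "(t + v) \<bullet> y = t \<bullet> y + v \<bullet> y" if "v \<in> carrier_vec N" "y \<in> carrier_vec N" for v y
    using that t by (simp add: add_scalar_prod_distrib[of _ N])
  \<comment> \<open>Orthogonality to x at least halves the solution set: the translate by t still
    satisfies the conditions for xs but pairs to 1 with x.\<close>
  have sub: "?K (x # xs) \<union> (+) t ` ?K (x # xs) \<subseteq> ?K xs"
    using t c e by (auto simp: subset_iff)
  have disj: "?K (x # xs) \<inter> (+) t ` ?K (x # xs) = {}"
    using t c e by auto
  have inj: "inj_on ((+) t) (?K (x # xs))"
    by (rule inj_on_inverseI[of _ "(+) t"]) (use t in auto)
  have "2 * card (?K (x # xs)) = card (?K (x # xs) \<union> (+) t ` ?K (x # xs))"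
    using card_Un_disjoint[OF fin finite_imageI[OF fin] disj] card_image[OF inj] by simp
  also have "\<dots> \<le> card (?K xs)" by (rule card_mono[OF fin sub])
  finally have "2 * card (?K (x # xs)) * 2 ^ length xs \<le> card (?K xs) * 2 ^ length xs" by simp
  also have "\<dots> \<le> 2 ^ N" using Cons.IH Cons.prems by simp
  finally show ?case by (simp add: ac_simps)
qed

text \<open>A totally isotropic span lies in its own annihilator, so 2 ^ r is at most 2 ^ (N - r),
  where r is the length of the list.\<close>

lemma length_totally_isotropic:
  assumes "set xs \<subseteq> carrier_vec N" "indep N xs" "totally_isotropic xs"
  shows "2 * length xs \<le> N"
proof -
  let ?K = "{v \<in> carrier_vec N. \<forall>x\<in>set xs. v \<bullet> x = (0 :: bit)}"
  have "fspan N xs \<subseteq> ?K"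
  proof
    fix v assume v: "v \<in> fspan N xs"
    have "v \<bullet> x = 0" if "x \<in> set xs" for x
      using fspan_orthogonal[OF assms(1) _ _ v, of x] assms that fspan_carrier[OF v]
        comm_scalar_prod[of v N x] by (auto simp: totally_isotropic_def subset_iff)
    then show "v \<in> ?K" using fspan_carrier[OF v] by simp
  qed
  then have "card (fspan N xs) \<le> card ?K"
    by (intro card_mono) (auto intro: finite_subset[OF _ card_carrier_bvec(1)[of N]])
  then have "2 ^ length xs * 2 ^ length xs \<le> card ?K * 2 ^ length xs"
    using card_fspan[OF assms(1,2)] by simp
  also have "\<dots> \<le> 2 ^ N" by (rule card_orthogonal_complement[OF assms(1,2)])
  finally have "(2::nat) ^ (2 * length xs) \<le> 2 ^ N" by (simp add: power_add mult_2)
  then show ?thesis by (simp add: power_increasing_iff)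
qed

text \<open>Write \<open>A + Id\<close> as the sum of \<open>x x\<^sup>T\<close> over a basis of its image. The constructors say where the
  all-ones vector lies: outside the image, the sum of the whole basis, or the sum of two basis
  vectors. The argument is the length of the basis; for the mirror constructors it refers to
  \<open>mirror A\<close>.\<close>

datatype inv_type = Outside nat | Outside_mirror nat | Full nat | Full_mirror nat | Pair nat

text \<open>The empty list is excluded: it belongs to the identity, which is counted as
  \<open>Full_mirror 1\<close>, since its mirror has the list \<open>[ones N]\<close>.\<close>

definition outside_type :: "nat \<Rightarrow> nat \<Rightarrow> bit mat \<Rightarrow> bool" where
  "outside_type N r A \<longleftrightarrow>
     (\<exists>xs. iso_decomp N A xs \<and> length xs = r \<and> xs \<noteq> [] \<and> ones N \<notin> fspan N xs)"

definition full_type :: "nat \<Rightarrow> nat \<Rightarrow> bit mat \<Rightarrow> bool" where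
  "full_type N r A \<longleftrightarrow>
     (\<exists>xs. iso_decomp N A xs \<and> length xs = r \<and> xs \<noteq> [] \<and> vsum N xs = ones N)"

text \<open>With \<open>zs\<close> empty this would be the full position of length two.\<close>

definition pair_type :: "nat \<Rightarrow> nat \<Rightarrow> bit mat \<Rightarrow> bool" where
  "pair_type N r A \<longleftrightarrow>
     (\<exists>x y zs. iso_decomp N A (x # y # zs) \<and> length (x # y # zs) = r \<and> zs \<noteq> [] \<and> x + y = ones N)"

fun has_type :: "nat \<Rightarrow> inv_type \<Rightarrow> bit mat \<Rightarrow> bool" where
  "has_type N (Outside r) A = outside_type N r A"
| "has_type N (Outside_mirror r) A = outside_type N r (mirror A)"
| "has_type N (Full r) A = full_type N r A"
| "has_type N (Full_mirror r) A = full_type N r (mirror A)"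
| "has_type N (Pair r) A = pair_type N r A"

section \<open>Involutions of the same type are conjugate\<close>

lemma iso_decomp_conj:
  assumes "iso_decomp N A xs" "iso_decomp N B ys" "P \<in> carrier (TO N)" "map ((*\<^sub>v) P) xs = ys"
  shows "B = P * A * transpose_mat P"
proof -
  note A = iso_decompD[OF assms(1)] and P = TO_E[OF assms(3)]
  have "P * A * transpose_mat P = 1\<^sub>m N + gram N ys"
    unfolding A(4) assms(4)[symmetric] mult_gram[OF P(1) A(1), symmetric]
    using conj_add[OF P(1) one_carrier_mat gram_carrier[OF A(1)]] P by simp
  then show ?thesis using iso_decompD(4)[OF assms(2)] by simp
qed

lemma outside_type_conj:
  assumes "outside_type N r A" "outside_type N r B"
  shows "\<exists>P\<in>carrier (TO N). B = P * A * transpose_mat P"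
proof -
  obtain xs ys where xs: "iso_decomp N A xs" "length xs = r" "ones N \<notin> fspan N xs"
    and ys: "iso_decomp N B ys" "length ys = r" "ones N \<notin> fspan N ys"
    using assms by (auto simp: outside_type_def)
  obtain P where "P \<in> carrier (TO N)" "map ((*\<^sub>v) P) xs = ys"
    using witt[of xs ys N] xs ys iso_decompD(1-3)[OF xs(1)] iso_decompD(1-3)[OF ys(1)] by auto
  then show ?thesis using iso_decomp_conj[OF xs(1) ys(1)] by blast
qed

text \<open>As \<open>ones N\<close> lies in the span, \<open>witt\<close> applies only to the
  tails. The heads follow: P fixes \<open>ones N\<close> and takes s to t, so it takes x, the sum of
  \<open>ones N\<close> and s, to y.\<close>

lemma iso_decomp_Cons_conj:
  assumes A: "iso_decomp N A (x # xs)" and B: "iso_decomp N B (y # ys)" and len: "length xs = length ys"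
    and s: "s \<in> fspan N xs" "x + s = ones N" and t: "t \<in> fspan N ys" "y + t = ones N"
    and st: "\<And>P. P \<in> carrier (TO N) \<Longrightarrow> map ((*\<^sub>v) P) xs = ys \<Longrightarrow> P *\<^sub>v s = t"
  shows "\<exists>P\<in>carrier (TO N). B = P * A * transpose_mat P"
proof -
  note A' = iso_decompD[OF A] and B' = iso_decompD[OF B]
  \<comment> \<open>Otherwise z, the sum of \<open>ones N\<close> and u, would lie in the span of
    zs, against independence.\<close>
  have notin: "ones N \<notin> fspan N zs"
    if "iso_decomp N C (z # zs)" "u \<in> fspan N zs" "z + u = ones N" for C z zs u
  proof
    note C = iso_decompD[OF that(1)]
    have c: "z \<in> carrier_vec N" "set zs \<subseteq> carrier_vec N" using C by auto
    have u: "u \<in> carrier_vec N" using that fspan_carrier by blast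
    assume "ones N \<in> fspan N zs"
    then have "u + z \<in> fspan N zs" using that(3) comm_add_vec[OF c(1) u] by simp
    then have "z \<in> fspan N zs" using fspan_add_iff[OF c(2) that(2) c(1)] by simp
    then show False using C(2) by simp
  qed
  obtain P where P: "P \<in> carrier (TO N)" "map ((*\<^sub>v) P) xs = ys"
    using witt[of xs ys N] A' B' len notin[OF A s] notin[OF B t] by (auto simp: totally_isotropic_def)
  have c: "x \<in> carrier_vec N" "s \<in> carrier_vec N" "y \<in> carrier_vec N" "t \<in> carrier_vec N"
    using A' B' s t fspan_carrier by auto
  have "P *\<^sub>v x + P *\<^sub>v s = P *\<^sub>v (x + s)"
    using c TO_E(1)[OF P(1)] by (simp add: mult_add_distrib_mat_vec[of _ N N])
  then have "P *\<^sub>v x + t = y + t" unfolding s(2) t(2) TO_mult_ones[OF P(1)] st[OF P] .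
  moreover have "P *\<^sub>v x \<in> carrier_vec N" using TO_E(1)[OF P(1)] c by simp
  ultimately have "P *\<^sub>v x = y" using c comm_add_vec bvec_add_cancel by metis
  then have "map ((*\<^sub>v) P) (x # xs) = y # ys" using P(2) by simp
  then show ?thesis using iso_decomp_conj[OF A B P(1)] by (intro bexI[OF _ P(1)])
qed

lemma mult_vec_vsum:
  assumes "P \<in> carrier_mat N N"
  shows "set xs \<subseteq> carrier_vec N \<Longrightarrow> P *\<^sub>v vsum N xs = vsum N (map ((*\<^sub>v) P) xs)"
proof (induction xs)
  case Nil
  show ?case using assms by (intro eq_vecI) auto
next
  case (Cons x xs)
  then show ?case using assms by (simp add: mult_add_distrib_mat_vec[of _ N N])
qed

lemma full_type_conj:
  assumes "full_type N r A" "full_type N r B"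
  shows "\<exists>P\<in>carrier (TO N). B = P * A * transpose_mat P"
proof -
  obtain x xs where xs: "iso_decomp N A (x # xs)" "length (x # xs) = r" "x + vsum N xs = ones N"
    using assms(1) unfolding full_type_def by (metis list.exhaust vsum.simps(2))
  obtain y ys where ys: "iso_decomp N B (y # ys)" "length (y # ys) = r" "y + vsum N ys = ones N"
    using assms(2) unfolding full_type_def by (metis list.exhaust vsum.simps(2))
  have c: "set xs \<subseteq> carrier_vec N" "set ys \<subseteq> carrier_vec N"
    using iso_decompD(1)[OF xs(1)] iso_decompD(1)[OF ys(1)] by auto
  show ?thesis
  proof (rule iso_decomp_Cons_conj[OF xs(1) ys(1) _ _ xs(3) _ ys(3)])
    fix P assume "P \<in> carrier (TO N)" "map ((*\<^sub>v) P) xs = ys"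
    then show "P *\<^sub>v vsum N xs = vsum N ys" using mult_vec_vsum[OF TO_E(1) c(1)] by simp
  qed (use xs ys c vsum_in_fspan in auto)
qed

lemma pair_type_conj:
  assumes "pair_type N r A" "pair_type N r B"
  shows "\<exists>P\<in>carrier (TO N). B = P * A * transpose_mat P"
proof -
  obtain x u xs where xs: "iso_decomp N A (x # u # xs)" "length (x # u # xs) = r" "x + u = ones N"
    using assms(1) unfolding pair_type_def by blast
  obtain y v ys where ys: "iso_decomp N B (y # v # ys)" "length (y # v # ys) = r" "y + v = ones N"
    using assms(2) unfolding pair_type_def by blast
  have "u \<in> carrier_vec N" "v \<in> carrier_vec N"
    using iso_decompD(1)[OF xs(1)] iso_decompD(1)[OF ys(1)] by auto
  then show ?thesis
    by (intro iso_decomp_Cons_conj[OF xs(1) ys(1) _ _ xs(3) _ ys(3)]) (use xs ys in auto)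
qed

lemma has_type_imp_conj_class_eq:
  assumes A: "A \<in> involutions N" and B: "B \<in> involutions N" and T: "has_type N T A" "has_type N T B"
  shows "conj_class (TO N) A = conj_class (TO N) B"
proof -
  note A' = involutionsD[OF A]
  have "\<exists>P\<in>carrier (TO N). B = P * A * transpose_mat P"
  proof -
    have mir: "\<exists>P\<in>carrier (TO N). B = P * A * transpose_mat P"
      if "\<exists>P\<in>carrier (TO N). mirror B = P * mirror A * transpose_mat P"
      using that mirror_conj[OF _ A'(2)] mirror_mirror by metis
    show ?thesis
      using T outside_type_conj full_type_conj pair_type_conj mir by (cases T) (auto; blast)+
  qed
  then show ?thesis using conj_class_eqI[OF A'(1)] by blast
qed

section \<open>Reading the type off \<open>DD\<close>\<close>

definition type_of_DD :: "nat \<times> nat \<times> nat \<times> nat \<Rightarrow> inv_type" where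
  "type_of_DD = (\<lambda>(a, b, c, d).
     if b = 0 then Full a else if d = 0 then Full_mirror c
     else if c = Suc a then Outside a else if a = Suc c then Outside_mirror c else Pair a)"

text \<open>The list of the mirror is longer by one. The diagonals of A and its mirror are
  \<open>ones N + vsum N xs\<close> and \<open>vsum N xs\<close>; both are nonzero, since the sum of
  a nonempty independent list is nonzero and lies in a span that misses
  \<open>ones N\<close>.\<close>

lemma outside_type_DD:
  assumes "outside_type N r A" "even N"
  shows "DD A = (r, 1, Suc r, 1)"
proof -
  obtain xs where xs: "iso_decomp N A xs" "length xs = r" "xs \<noteq> []" "ones N \<notin> fspan N xs"
    using assms(1) by (auto simp: outside_type_def)
  note A = iso_decompD[OF xs(1)]
  note m = iso_decomp_mirror[OF xs(1) assms(2) xs(4)]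
  have v: "vsum N xs \<in> carrier_vec N" "vsum N xs \<noteq> 0\<^sub>v N" "vsum N xs \<noteq> ones N"
    using A xs vsum_nonzero vsum_in_fspan[OF A(1)] by auto
  have d: "diag_vec A = ones N + vsum N xs" by (rule diag_iso_decomp[OF xs(1)])
  then have 1: "diag_vec A \<noteq> 0\<^sub>v N"
    using v bvec_add_eq_iff[of "ones N" N "vsum N xs" "0\<^sub>v N"] by auto
  have "diag_vec (mirror A) = vsum N xs"
    unfolding diag_mirror[OF A(5)] d by (rule bvec_add_cancel[OF ones_carrier v(1)])
  then have 2: "diag_vec (mirror A) \<noteq> 0\<^sub>v N" using v by simp
  show ?thesis
    using inv_D_iso_decomp[OF xs(1)] inv_D_iso_decomp[OF m] xs(2) 1 2
      inv_alpha_symmetric[OF A(5,7)] inv_alpha_symmetric[OF iso_decompD(5,7)[OF m]]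
    by (simp add: DD_def)
qed

lemma DD_mirror: "DD A = (a, b, c, d) \<Longrightarrow> DD (mirror A) = (c, d, a, b)"
  by (simp add: DD_def)

text \<open>The full sum cancels the diagonal of the identity. The third component depends on the
  parity of r: it is r for even and r - 1 for odd r. The vanishing second component already
  identifies the position.\<close>

lemma full_type_DD:
  assumes "full_type N r A" "N > 0"
  shows "\<exists>c. DD A = (r, 0, c, 1)"
proof -
  obtain xs where xs: "iso_decomp N A xs" "length xs = r" "vsum N xs = ones N"
    using assms(1) by (auto simp: full_type_def)
  note A = iso_decompD[OF xs(1)]
  have d: "diag_vec A = 0\<^sub>v N" using diag_iso_decomp[OF xs(1)] xs(3) by simp
  then have "diag_vec (mirror A) = ones N" using diag_mirror[OF A(5)] by simp
  moreover have "ones N \<noteq> 0\<^sub>v N" using ones_neq_zero[OF assms(2)] .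
  ultimately show ?thesis
    using inv_D_iso_decomp[OF xs(1)] xs(2) d inv_alpha_symmetric[OF A(5,7)]
      inv_alpha_symmetric[of "mirror A" N] A by (simp add: DD_def transpose_mirror)
qed

text \<open>A hyperbolic plane plus \<open>\<langle>1\<rangle>\<close> is isometric to \<open>\<langle>1, 1, 1\<rangle>\<close> over the field with two elements.\<close>

lemma gram_hyperbolic:
  assumes "set (x # y # z # zs) \<subseteq> carrier_vec N"
  shows "outer (x + y) + gram N (x # y # z # zs) = gram N ((x + z) # (y + z) # (x + (y + z)) # zs)"
proof -
  \<comment> \<open>The identity for one matrix entry. The first three products on the left add up
    to a * b' + b * a', the hyperbolic form.\<close>
  have id: "(a + b) * (a' + b') + (a * a' + (b * b' + (c * c' + g))) =
      (a + c) * (a' + c') + ((b + c) * (b' + c') + ((a + (b + c)) * (a' + (b' + c')) + g))"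
    for a b c a' b' c' g :: bit
    by (cases a; cases b; cases c; cases a'; cases b'; cases c') simp_all
  have c: "x \<in> carrier_vec N" "y \<in> carrier_vec N" "z \<in> carrier_vec N" "gram N zs \<in> carrier_mat N N"
    using assms by simp_all
  show ?thesis by (rule eq_matI) (use c in \<open>simp_all add: outer_def id\<close>)
qed

text \<open>Adding the square of x + y makes the orthonormal plane of x, y hyperbolic. The further
  vector z restores an orthonormal basis of the same length, so mirroring preserves the rank
  here.\<close>

lemma iso_decomp_hyperbolic:
  assumes A: "iso_decomp N A (x # y # z # zs)" and xy: "x + y = ones N"
  shows "iso_decomp N (mirror A) ((x + z) # (y + z) # (x + (y + z)) # zs)"
proof -
  note A' = iso_decompD[OF A]
  have c: "x \<in> carrier_vec N" "y \<in> carrier_vec N" "z \<in> carrier_vec N" "set zs \<subseteq> carrier_vec N"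
    using A' by auto
  have "mirror A = 1\<^sub>m N + gram N ((x + z) # (y + z) # (x + (y + z)) # zs)"
    unfolding mirror_eq[OF A'(5)] gram_hyperbolic[OF A'(1), symmetric] xy
    using A'(1) unfolding A'(4)
    by (intro eq_matI) (simp_all add: outer_def ac_simps del: bit_add_left_cancel2)
  moreover have "totally_isotropic ((x + z) # (y + z) # (x + (y + z)) # zs)"
  proof -
    \<comment> \<open>The whole span is totally isotropic, so every list inside it is.\<close>
    have "fspan N (x # y # z # zs) \<subseteq> {v \<in> carrier_vec N. \<forall>w\<in>fspan N (x # y # z # zs). v \<bullet> w = 0}"
    proof
      fix v assume v: "v \<in> fspan N (x # y # z # zs)"
      have vc: "v \<in> carrier_vec N" by (rule fspan_carrier[OF v])
      have "v \<bullet> w = 0" if w: "w \<in> fspan N (x # y # z # zs)" for w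
      proof (rule fspan_orthogonal[OF A'(1) vc _ w], rule ballI)
        fix u assume u: "u \<in> set (x # y # z # zs)"
        have uc: "u \<in> carrier_vec N" using u A'(1) by blast
        have "u \<bullet> v = 0" using fspan_orthogonal[OF A'(1) uc _ v] u A'(3) by (auto simp: totally_isotropic_def)
        then show "v \<bullet> u = 0" using comm_scalar_prod[OF uc vc] by simp
      qed
      then show "v \<in> {v \<in> carrier_vec N. \<forall>w\<in>fspan N (x # y # z # zs). v \<bullet> w = 0}" using vc by blast
    qed
    moreover have "set ((x + z) # (y + z) # (x + (y + z)) # zs) \<subseteq> fspan N (x # y # z # zs)"
    proof -
      have "set (x # y # z # zs) \<subseteq> fspan N (x # y # z # zs)" by (rule set_subset_fspan[OF A'(1)])
      then show ?thesis using fspan_add[OF A'(1)] by (simp del: fspan.simps)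
    qed
    ultimately show ?thesis unfolding totally_isotropic_def by blast
  qed
  moreover have "indep N ((x + z) # (y + z) # (x + (y + z)) # zs)"
  proof -
    let ?S = "fspan N zs"
    \<comment> \<open>None of the seven nonzero combinations of x, y, z lies in the span of zs, and
      the change of basis permutes these seven.\<close>
    have n: "z \<notin> ?S" "y \<notin> ?S" "z + y \<notin> ?S" "x \<notin> ?S" "z + x \<notin> ?S" "y + x \<notin> ?S" "z + (y + x) \<notin> ?S"
      using A'(2) c by auto
    have e: "z + (y + x) = x + (y + z)" "z + y = y + z" "z + x = x + z" "x + (y + z) + (y + z) = x"
      "y + z + (x + z) = y + x" "x + (y + z) + (x + z) = y" "x + (y + z) + (y + z + (x + z)) = z"
      "x + (y + (x + (y + z))) = z"
      using c by (auto intro!: eq_vecI simp: ac_simps)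
    show ?thesis using n A'(2) c unfolding e by (simp add: e)
  qed
  ultimately show ?thesis using c by (simp add: iso_decomp_def)
qed

text \<open>As x + y is \<open>ones N\<close>, it cancels the diagonal of the identity and leaves
  the sum of the remaining vectors, which is nonzero because there is at least one.\<close>

lemma pair_type_DD:
  assumes "pair_type N r A"
  shows "DD A = (r, 1, r, 1)"
proof -
  obtain x y z zs where xs: "iso_decomp N A (x # y # z # zs)" "length (x # y # z # zs) = r" "x + y = ones N"
    using assms unfolding pair_type_def by (metis list.exhaust)
  note A = iso_decompD[OF xs(1)]
  note m = iso_decomp_hyperbolic[OF xs(1,3)]
  have c: "x \<in> carrier_vec N" "y \<in> carrier_vec N" "set (z # zs) \<subseteq> carrier_vec N" "indep N (z # zs)"
    using A by auto
  have v: "vsum N (z # zs) \<in> carrier_vec N" "vsum N (z # zs) \<noteq> 0\<^sub>v N"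
    using vsum_carrier[OF c(3)] vsum_nonzero[OF c(3,4)] by blast+
  have s: "vsum N (x # y # z # zs) = ones N + vsum N (z # zs)"
    unfolding xs(3)[symmetric] using c v assoc_add_vec[of x N y "vsum N (z # zs)"] by simp
  have d: "diag_vec A = vsum N (z # zs)"
    unfolding diag_iso_decomp[OF xs(1)] s by (rule bvec_add_cancel[OF ones_carrier v(1)])
  have "diag_vec (mirror A) = vsum N (x # y # z # zs)" unfolding diag_mirror[OF A(5)] d s ..
  moreover have "vsum N (x # y # z # zs) \<noteq> 0\<^sub>v N" using vsum_nonzero[OF A(1,2)] by blast
  ultimately show ?thesis
    using inv_D_iso_decomp[OF xs(1)] inv_D_iso_decomp[OF m] xs(2) d v(2)
      inv_alpha_symmetric[OF A(5,7)] inv_alpha_symmetric[OF iso_decompD(5,7)[OF m]]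
    by (simp add: DD_def)
qed

text \<open>A vanishing second or fourth component marks the two full positions. Otherwise the rank
  of the mirror is larger by one, smaller by one or equal, for \<open>Outside\<close>,
  \<open>Outside_mirror\<close> and \<open>Pair\<close>. In particular an involution has only one
  type.\<close>

lemma type_of_DD_has_type:
  assumes "has_type N T A" "even N" "N > 0"
  shows "type_of_DD (DD A) = T"
proof (cases T)
  case (Outside r)
  then show ?thesis using outside_type_DD assms by (auto simp: type_of_DD_def)
next
  case (Outside_mirror r)
  then have "DD A = (Suc r, 1, r, 1)"
    using outside_type_DD[of N r "mirror A"] DD_mirror[of "mirror A"] assms by simp
  then show ?thesis using Outside_mirror by (simp add: type_of_DD_def)
next
  case (Full r)
  then show ?thesis using full_type_DD[of N r A] assms by (auto simp: type_of_DD_def)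
next
  case (Full_mirror r)
  then obtain c where "DD A = (c, 1, r, 0)"
    using full_type_DD[of N r "mirror A"] DD_mirror[of "mirror A"] assms by auto
  then show ?thesis using Full_mirror by (simp add: type_of_DD_def)
next
  case (Pair r)
  then show ?thesis using pair_type_DD[of N r A] assms by (simp add: type_of_DD_def)
qed

text \<open>Isotropy in dimension 2n bounds the length by n, and by n - 1 if the all-ones vector can
  still be adjoined; a pair list has at least three entries.\<close>

definition valid_types :: "nat \<Rightarrow> inv_type set" where
  "valid_types n = Outside ` {1..n - 1} \<union> Outside_mirror ` {1..n - 1} \<union> Full ` {1..n} \<union> Full_mirror ` {1..n}
     \<union> Pair ` {3..n}"

text \<open>For n = 1 there are two valid types while 5 * n - 4 is 1, because \<open>{3..n}\<close>
  is already empty for n = 2.\<close>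

lemma card_valid_types:
  assumes "n \<ge> 2"
  shows "card (valid_types n) = 5 * n - 4"
proof -
  have "card (valid_types n) = (n - 1) + (n - 1) + n + n + (n - 2)"
    unfolding valid_types_def
    by (subst card_Un_disjoint; auto simp: card_image inj_on_def)+
  then show ?thesis using assms by simp
qed

text \<open>The length bound is applied to the list of the mirror, which is longer by one.\<close>

lemma outside_type_bound:
  assumes "outside_type (2 * n) r A"
  shows "1 \<le> r \<and> r \<le> n - 1"
proof -
  obtain xs where xs: "iso_decomp (2 * n) A xs" "length xs = r" "xs \<noteq> []" "ones (2 * n) \<notin> fspan (2 * n) xs"
    using assms by (auto simp: outside_type_def)
  have "2 * Suc (length xs) \<le> 2 * n"
    using length_totally_isotropic[OF iso_decompD(1-3)[OF iso_decomp_mirror[OF xs(1) _ xs(4)]]] by simp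
  then show ?thesis using xs by (cases xs) auto
qed

lemma has_type_valid:
  assumes "has_type (2 * n) T A"
  shows "T \<in> valid_types n"
proof -
  have full: "1 \<le> r \<and> r \<le> n" if "full_type (2 * n) r B" for r B
    using that length_totally_isotropic[OF iso_decompD(1-3)]
    by (fastforce simp: full_type_def Suc_le_eq)
  have pair: "3 \<le> r \<and> r \<le> n" if p: "pair_type (2 * n) r B" for r B
  proof -
    obtain x y zs where xs: "iso_decomp (2 * n) B (x # y # zs)" "length (x # y # zs) = r" "zs \<noteq> []"
      using p by (auto simp: pair_type_def)
    then show ?thesis
      using length_totally_isotropic[OF iso_decompD(1-3)[OF xs(1)]] by (cases zs) auto
  qed
  show ?thesis
    using assms outside_type_bound full pair by (cases T) (auto simp: valid_types_def)
qed

section \<open>Every involution has a type\<close>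

lemma involution_plus_one:
  assumes "A \<in> involutions N"
  defines "M \<equiv> A + 1\<^sub>m N"
  shows "M \<in> carrier_mat N N" "transpose_mat M = M" "A = 1\<^sub>m N + M" "diag_vec M = diag_vec A + ones N"
    "\<And>v w. v \<in> carrier_vec N \<Longrightarrow> w \<in> carrier_vec N \<Longrightarrow> (M *\<^sub>v v) \<bullet> (M *\<^sub>v w) = 0"
proof -
  note A = involutionsD[OF assms(1)]
  show M: "M \<in> carrier_mat N N" using A by (simp add: M_def)
  show sym: "transpose_mat M = M" using A transpose_add[of A N N "1\<^sub>m N"] by (simp add: M_def)
  show "A = 1\<^sub>m N + M" unfolding M_def using A(2) by (intro eq_matI) (auto simp: ac_simps)
  show "diag_vec M = diag_vec A + ones N" unfolding M_def using A(2) by (simp add: diag_vec_add[of _ N] diag_vec_one)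
  fix v w :: "bit vec" assume v: "v \<in> carrier_vec N" and w: "w \<in> carrier_vec N"
  have Mv: "M *\<^sub>v u = A *\<^sub>v u + u" if "u \<in> carrier_vec N" for u
    unfolding M_def using A(2) that by (simp add: add_mult_distrib_mat_vec[of _ N N])
  have Aw: "A *\<^sub>v w \<in> carrier_vec N" using A w by simp
  have "A *\<^sub>v (A *\<^sub>v w) = w" using A(3) w assoc_mult_mat_vec[OF A(2,2) w] by simp
  then have "M *\<^sub>v (M *\<^sub>v w) = (w + A *\<^sub>v w) + (A *\<^sub>v w + w)"
    using w Aw A(2) by (simp add: Mv mult_add_distrib_mat_vec[of _ N N])
  also have "\<dots> = 0\<^sub>v N"
    unfolding comm_add_vec[OF Aw w] by (rule bvec_add_self[OF add_carrier_vec[OF w Aw]])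
  finally have "v \<bullet> (M *\<^sub>v (M *\<^sub>v w)) = 0" using v by simp
  then show "(M *\<^sub>v v) \<bullet> (M *\<^sub>v w) = 0"
    using symmetric_scalar_prod[OF M sym v, of "M *\<^sub>v w"] M w by simp
qed

lemma iso_decompI:
  assumes A: "A \<in> involutions N" and xs: "set xs \<subseteq> (*\<^sub>v) (A + 1\<^sub>m N) ` carrier_vec N"
    and "indep N xs" "A + 1\<^sub>m N = gram N xs"
  shows "iso_decomp N A xs"
proof -
  note M = involution_plus_one[OF A]
  have "set xs \<subseteq> carrier_vec N" using xs mult_mat_vec_carrier[OF M(1)] by blast
  moreover have "totally_isotropic xs"
    unfolding totally_isotropic_def
  proof (intro ballI)
    fix x y assume "x \<in> set xs" "y \<in> set xs"
    then obtain v w where "v \<in> carrier_vec N" "w \<in> carrier_vec N"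
      "x = (A + 1\<^sub>m N) *\<^sub>v v" "y = (A + 1\<^sub>m N) *\<^sub>v w" using xs by blast
    then show "x \<bullet> y = 0" using M(5) by blast
  qed
  moreover have "A = 1\<^sub>m N + gram N xs" using M(3) assms(4) by simp
  ultimately show ?thesis using assms(3) by (simp add: iso_decomp_def)
qed

lemma involution_iso_decomp:
  assumes A: "A \<in> involutions N" and d: "diag_vec A + ones N \<noteq> 0\<^sub>v N"
  shows "\<exists>xs. iso_decomp N A xs \<and> xs \<noteq> [] \<and> set xs \<subseteq> (*\<^sub>v) (A + 1\<^sub>m N) ` carrier_vec N
    \<and> vsum N xs = diag_vec A + ones N"
proof -
  note M = involution_plus_one[OF A]
  obtain xs where xs: "set xs \<subseteq> (*\<^sub>v) (A + 1\<^sub>m N) ` carrier_vec N" "indep N xs" "A + 1\<^sub>m N = gram N xs"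
    using symmetric_eq_gram[OF M(1,2)] d M(4) by auto
  have iso: "iso_decomp N A xs" by (rule iso_decompI[OF A xs])
  have "vsum N xs = diag_vec A + ones N"
    using diag_vec_gram[OF iso_decompD(1)[OF iso]] M(4) xs(3) by simp
  then show ?thesis using xs iso d by (intro exI[of _ xs]) auto
qed

lemma range_symmetric_orthogonal:
  assumes "M \<in> carrier_mat N N" "transpose_mat M = M" "v \<in> carrier_vec N" "M *\<^sub>v v = (0\<^sub>v N :: bit vec)"
    "x \<in> (*\<^sub>v) M ` carrier_vec N"
  shows "v \<bullet> x = 0"
proof -
  obtain w where w: "w \<in> carrier_vec N" "x = M *\<^sub>v w" using assms(5) by auto
  then show ?thesis using symmetric_scalar_prod[OF assms(1-3) w(1)] assms(4) by simp
qed

text \<open>By symmetry the kernel vector y of \<open>mirror A + 1\<^sub>m N\<close> annihilates its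
  image, but y pairs to 1 with \<open>ones N\<close>. The nonzero \<open>diag_vec A\<close> is the
  diagonal of that matrix and supplies the orthonormal basis.\<close>

lemma outside_typeI_mirror:
  assumes A: "A \<in> involutions N" and "even N" and d: "diag_vec A \<noteq> 0\<^sub>v N"
    and y: "y \<in> carrier_vec N" "(A + 1\<^sub>m N) *\<^sub>v y = ones N" "y \<bullet> ones N = 1"
  shows "\<exists>r. outside_type N r (mirror A)"
proof -
  note A' = involutionsD[OF A]
  have mA: "mirror A \<in> involutions N" by (rule mirror_involution[OF A assms(2)])
  note M' = involution_plus_one[OF mA]
  have dA: "diag_vec A \<in> carrier_vec N" using A' by simp
  have "diag_vec (mirror A) + ones N = diag_vec A"
    unfolding diag_mirror[OF A'(2)] using dA by (intro eq_vecI) (auto simp: ac_simps)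
  then obtain xs where xs: "iso_decomp N (mirror A) xs" "xs \<noteq> []"
      "set xs \<subseteq> (*\<^sub>v) (mirror A + 1\<^sub>m N) ` carrier_vec N"
    using involution_iso_decomp[OF mA] d by auto
  have "mirror A + 1\<^sub>m N = outer (ones N) + (A + 1\<^sub>m N)"
    unfolding mirror_eq[OF A'(2)] using A'(2) by (simp add: assoc_add_mat[of _ N N])
  then have "(mirror A + 1\<^sub>m N) *\<^sub>v y = (ones N \<bullet> y) \<cdot>\<^sub>v ones N + (A + 1\<^sub>m N) *\<^sub>v y"
    using A'(2) y(1) add_mult_distrib_mat_vec[of "outer (ones N)" N N "A + 1\<^sub>m N" y]
    by (simp add: outer_mult_vec[of _ N])
  also have "\<dots> = 0\<^sub>v N"
    using y comm_scalar_prod[OF y(1) ones_carrier] bvec_add_self[OF ones_carrier] by simp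
  finally have ker: "(mirror A + 1\<^sub>m N) *\<^sub>v y = 0\<^sub>v N" .
  have "\<forall>x\<in>set xs. y \<bullet> x = 0"
    using range_symmetric_orthogonal[OF M'(1,2) y(1) ker] xs(3) by blast
  then have "ones N \<notin> fspan N xs"
    using fspan_orthogonal[OF iso_decompD(1)[OF xs(1)] y(1)] y(3) by auto
  then show ?thesis using xs by (auto simp: outside_type_def)
qed

text \<open>In the form on the image, \<open>ones N\<close> is isotropic. It is split as y + z with
  y, z orthonormal; both squares are removed from A + Id, and \<open>symmetric_eq_gram\<close>
  treats the rest.\<close>

lemma pair_typeI:
  assumes A: "A \<in> involutions N" and d: "diag_vec A \<noteq> 0\<^sub>v N" "diag_vec A \<noteq> ones N" and N: "N > 0"
    and y0: "y0 \<in> carrier_vec N" "(A + 1\<^sub>m N) *\<^sub>v y0 = ones N" "y0 \<bullet> ones N = 0"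
  shows "\<exists>r. pair_type N r A"
proof -
  let ?M = "A + 1\<^sub>m N" and ?d = "diag_vec A + ones N"
  note A' = involutionsD[OF A] and M = involution_plus_one[OF A]
  have dA: "diag_vec A \<in> carrier_vec N" and dc: "?d \<in> carrier_vec N" using A' by auto
  have dnz: "?d \<noteq> 0\<^sub>v N" using d(2) bvec_add_eq_iff[OF dA ones_carrier, of "0\<^sub>v N"] dA by auto
  have onz: "ones N \<noteq> 0\<^sub>v N" using ones_neq_zero[OF N] .
  \<comment> \<open>For y = M v these two values are the form on the image at (y, y) and (y,
    \<open>ones N\<close>); both being 1, the vectors y and \<open>ones N + y\<close> are
    orthonormal.\<close>
  obtain v where v: "v \<in> carrier_vec N" "v \<bullet> ?d = 1" "v \<bullet> ones N = 1"
    using fspan_separating_vec2[of "[]" N ?d "ones N"] dc dnz onz by auto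
  define y where "y = ?M *\<^sub>v v"
  define z where "z = ones N + y"
  define u where "u = y0 + v"
  have y: "y \<in> carrier_vec N" unfolding y_def by (rule mult_mat_vec_carrier[OF M(1) v(1)])
  have z: "z \<in> carrier_vec N" using y z_def by simp
  have u: "u \<in> carrier_vec N" using y0 v u_def by simp
  \<comment> \<open>u and v are preimages of z and y, so the products below evaluate the form on the
    image.\<close>
  have Mu: "?M *\<^sub>v u = z"
    unfolding u_def z_def y_def using mult_add_distrib_mat_vec[OF M(1) y0(1) v(1)] y0(2) by simp
  have vy: "v \<bullet> y = 1"
    using quadratic_form_eq_diag[OF M(1,2) v(1)] v(2) comm_scalar_prod[OF v(1) dc] M(4) y_def by simp
  have y0y: "y0 \<bullet> y = 1"
    unfolding y_def using symmetric_scalar_prod[OF M(1,2) y0(1) v(1)] y0(2) comm_scalar_prod[OF v(1) ones_carrier] v(3)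
    by simp
  have vz: "v \<bullet> z = 0" unfolding z_def using v vy y by (simp add: scalar_prod_add_distrib[of _ N])
  have uy: "u \<bullet> y = 0" unfolding u_def using y0 v y y0y vy by (simp add: add_scalar_prod_distrib[of _ N])
  have "u \<bullet> ones N = 1" unfolding u_def using y0 v by (simp add: add_scalar_prod_distrib[of _ N])
  then have uz: "u \<bullet> z = 1" unfolding z_def using u uy y by (simp add: scalar_prod_add_distrib[of _ N])
  let ?M' = "outer z + (outer y + ?M)"
  have M': "?M' \<in> carrier_mat N N" using M(1) y z by simp
  have sym': "transpose_mat ?M' = ?M'"
    using M(1,2) y z transpose_add[of "outer y" N N ?M] transpose_add[of "outer z" N N "outer y + ?M"]
    by (simp add: transpose_outer)
  have M'v: "?M' *\<^sub>v w = (w \<bullet> z) \<cdot>\<^sub>v z + ((w \<bullet> y) \<cdot>\<^sub>v y + ?M *\<^sub>v w)" if w: "w \<in> carrier_vec N" for w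
    using w y z M(1) add_mult_distrib_mat_vec[of "outer z" N N "outer y + ?M" w]
      add_mult_distrib_mat_vec[of "outer y" N N ?M w] comm_scalar_prod[OF w z] comm_scalar_prod[OF w y]
    by (simp add: outer_mult_vec[of _ N])
  have M'v0: "?M' *\<^sub>v v = 0\<^sub>v N" using M'v[OF v(1)] vz vy y z by (simp add: smult_bit_vec flip: y_def)
  have M'u0: "?M' *\<^sub>v u = 0\<^sub>v N" using M'v[OF u] uz uy y z by (simp add: smult_bit_vec Mu)
  \<comment> \<open>As z + y = \<open>ones N\<close> cancels the \<open>ones N\<close> in the
    diagonal of A + Id, the remainder has the nonzero diagonal \<open>diag_vec A\<close>.\<close>
  have "diag_vec ?M' = z + (y + ?d)"
    using M(1,4) y z by (simp add: diag_vec_add[of _ N] diag_vec_outer)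
  also have "\<dots> = diag_vec A" unfolding z_def using y dA by (intro eq_vecI) (auto simp: ac_simps)
  finally have d': "diag_vec ?M' = diag_vec A" .
  obtain ws where ws: "set ws \<subseteq> (*\<^sub>v) ?M' ` carrier_vec N" "indep N ws" "?M' = gram N ws"
    using symmetric_eq_gram[OF M' sym'] d' d(1) by auto
  have wsc: "set ws \<subseteq> carrier_vec N" using ws(1) mult_mat_vec_carrier[OF M'] by blast
  \<comment> \<open>The kernel vectors v and u annihilate ws and are dual to y and z, which yields
    independence.\<close>
  have orth: "\<forall>x\<in>set ws. v \<bullet> x = 0" "\<forall>x\<in>set ws. u \<bullet> x = 0"
    using range_symmetric_orthogonal[OF M' sym'] v(1) u M'v0 M'u0 ws(1) by blast+
  have "z \<notin> fspan N ws" using fspan_orthogonal[OF wsc u orth(2)] uz by auto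
  moreover have "y \<notin> fspan N (z # ws)"
    using fspan_orthogonal[of "z # ws" N v y] wsc z v(1) orth(1) vz vy by (auto simp del: fspan.simps)
  ultimately have ind: "indep N (y # z # ws)" using ws(2) by simp
  have range: "set (y # z # ws) \<subseteq> (*\<^sub>v) ?M ` carrier_vec N"
  proof -
    have "?M' *\<^sub>v w \<in> (*\<^sub>v) ?M ` carrier_vec N" if w: "w \<in> carrier_vec N" for w
    proof (rule image_eqI)
      show "(w \<bullet> z) \<cdot>\<^sub>v u + ((w \<bullet> y) \<cdot>\<^sub>v v + w) \<in> carrier_vec N" using w u v by simp
      show "?M' *\<^sub>v w = ?M *\<^sub>v ((w \<bullet> z) \<cdot>\<^sub>v u + ((w \<bullet> y) \<cdot>\<^sub>v v + w))"
        unfolding M'v[OF w] using w u v mult_add_distrib_mat_vec[OF M(1)] mult_mat_vec[OF M(1)]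
        by (simp add: Mu flip: y_def)
    qed
    then have "set ws \<subseteq> (*\<^sub>v) ?M ` carrier_vec N" using ws(1) by blast
    moreover have "y \<in> (*\<^sub>v) ?M ` carrier_vec N" using v(1) y_def by blast
    moreover have "z \<in> (*\<^sub>v) ?M ` carrier_vec N" using u Mu by blast
    ultimately show ?thesis by simp
  qed
  have "gram N (y # z # ws) = ?M"
    using ws(3) M(1) y z bmat_add_cancel[of "outer y" N N ?M] bmat_add_cancel[of "outer z" N N "outer y + ?M"]
    by simp
  then have iso: "iso_decomp N A (y # z # ws)" using iso_decompI[OF A range ind] by simp
  have "y + z = ones N" unfolding z_def using y comm_add_vec[OF ones_carrier y] by simp
  moreover have "ws \<noteq> []"
  proof
    assume "ws = []"
    then have "diag_vec A = 0\<^sub>v N" using ws(3) d' diag_vec_gram[of "[]" N] by simp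
    then show False using d(1) by simp
  qed
  ultimately show ?thesis using iso unfolding pair_type_def by blast
qed

text \<open>A + Id has diagonal \<open>diag_vec A + ones N\<close>. So if A has diagonal zero, the
  basis sums to \<open>ones N\<close>; diagonal \<open>ones N\<close> is the same case for the
  mirror. Otherwise the place of \<open>ones N\<close> relative to the image decides.\<close>

lemma involution_has_type:
  assumes A: "A \<in> involutions N" and "even N" "N > 0"
  shows "\<exists>T. has_type N T A"
proof -
  note A' = involutionsD[OF A]
  have dA: "diag_vec A \<in> carrier_vec N" using A' by simp
  have onz: "ones N \<noteq> 0\<^sub>v N" using ones_neq_zero[OF assms(3)] .
  have full: "\<exists>r. full_type N r B" if "B \<in> involutions N" "diag_vec B = 0\<^sub>v N" for B
    using involution_iso_decomp[OF that(1)] that(2) onz by (auto simp: full_type_def)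
  consider "diag_vec A = ones N" | "diag_vec A = 0\<^sub>v N" | "diag_vec A \<noteq> ones N" "diag_vec A \<noteq> 0\<^sub>v N" by blast
  then show ?thesis
  proof cases
    case 1
    have "diag_vec (mirror A) = 0\<^sub>v N" using diag_mirror[OF A'(2)] 1 bvec_add_self[OF ones_carrier] by simp
    then show ?thesis using full[OF mirror_involution[OF A assms(2)]] has_type.simps(4) by blast
  next
    case 2
    then show ?thesis using full[OF A] has_type.simps(3) by blast
  next
    case 3
    have "diag_vec A + ones N \<noteq> 0\<^sub>v N" using 3 bvec_add_eq_iff[OF dA ones_carrier, of "0\<^sub>v N"] dA by auto
    then obtain xs where xs: "iso_decomp N A xs" "xs \<noteq> []" using involution_iso_decomp[OF A] by blast
    show ?thesis
    proof (cases "ones N \<in> fspan N xs")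
      case False
      then have "has_type N (Outside (length xs)) A" using xs by (auto simp: outside_type_def)
      then show ?thesis ..
    next
      case True
      note D = iso_decompD[OF xs(1)]
      have "ones N \<in> (*\<^sub>v) (A + 1\<^sub>m N) ` carrier_vec N"
        unfolding D(6) using fspan_subset_range_gram[OF D(1,2)] True by (rule subsetD)
      then obtain y where y: "y \<in> carrier_vec N" "(A + 1\<^sub>m N) *\<^sub>v y = ones N"
        by (elim imageE) simp
      show ?thesis
      \<comment> \<open>This is the value of the form on the image at \<open>ones N\<close>.\<close>
      proof (cases "y \<bullet> ones N = 1")
        case True
        then show ?thesis using outside_typeI_mirror[OF A assms(2) 3(2) y] has_type.simps(2) by blast
      next
        case False
        then obtain r where "pair_type N r A" using pair_typeI[OF A 3(2,1) assms(3) y] by auto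
        then show ?thesis using has_type.simps(5) by blast
      qed
    qed
  qed
qed

section \<open>Representatives\<close>

lemma ones_append: "ones (a + b) = ones a @\<^sub>v ones b"
  by (intro eq_vecI) auto

definition block_list :: "nat \<Rightarrow> nat \<Rightarrow> bit vec list \<Rightarrow> bit vec list \<Rightarrow> bit vec list" where
  "block_list a b xs ys = map (\<lambda>x. x @\<^sub>v 0\<^sub>v b) xs @ map (\<lambda>y. 0\<^sub>v a @\<^sub>v y) ys"

lemma block_list_Cons: "block_list a b (x # xs) ys = (x @\<^sub>v 0\<^sub>v b) # block_list a b xs ys"
  and block_list_Nil: "block_list a b [] [] = []"
  and block_list_Nil_Cons: "block_list a b [] (y # ys) = (0\<^sub>v a @\<^sub>v y) # block_list a b [] ys"
  and length_block_list: "length (block_list a b xs ys) = length xs + length ys"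
  by (simp_all add: block_list_def)

lemma zero_append_zero: "0\<^sub>v a @\<^sub>v 0\<^sub>v b = (0\<^sub>v (a + b) :: bit vec)"
  by (intro eq_vecI) auto

lemma append_vec_plus:
  assumes "u \<in> carrier_vec a" "u' \<in> carrier_vec a" "v \<in> carrier_vec b" "v' \<in> carrier_vec b"
  shows "(u @\<^sub>v v) + (u' @\<^sub>v v') = (u + u') @\<^sub>v (v + v' :: bit vec)"
  using assms by (intro eq_vecI) auto

lemma block_list_carrier:
  assumes "set xs \<subseteq> carrier_vec a" "set ys \<subseteq> carrier_vec b"
  shows "set (block_list a b xs ys) \<subseteq> carrier_vec (a + b)"
  using assms by (auto simp: block_list_def)

lemma append_in_fspan_block_list:
  assumes xs: "set xs \<subseteq> carrier_vec a" and ys: "set ys \<subseteq> carrier_vec b"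
  shows "u \<in> carrier_vec a \<Longrightarrow> v \<in> carrier_vec b \<Longrightarrow>
    u @\<^sub>v v \<in> fspan (a + b) (block_list a b xs ys) \<longleftrightarrow> u \<in> fspan a xs \<and> v \<in> fspan b ys"
  using xs
proof (induction xs arbitrary: u)
  case Nil
  note u = Nil(1)
  show ?case using ys Nil(2)
  proof (induction ys arbitrary: v)
    case Nil
    then show ?case using u append_vec_eq[of u a "0\<^sub>v a" v "0\<^sub>v b"]
      by (simp add: block_list_Nil zero_append_zero[symmetric])
  next
    case (Cons y ys)
    have "(0\<^sub>v a @\<^sub>v y) + (u @\<^sub>v v) = u @\<^sub>v (y + v)"
      using Cons.prems u append_vec_plus[of "0\<^sub>v a" a u y b v] by simp
    then show ?case using Cons u by (auto simp: block_list_Nil_Cons)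
  qed
next
  case (Cons x xs)
  have "(x @\<^sub>v 0\<^sub>v b) + (u @\<^sub>v v) = (x + u) @\<^sub>v v"
    using Cons.prems append_vec_plus[of x a u "0\<^sub>v b" b v] by simp
  then show ?case using Cons by (auto simp: block_list_Cons)
qed

lemma indep_block_list:
  assumes xs: "set xs \<subseteq> carrier_vec a" "indep a xs" and ys: "set ys \<subseteq> carrier_vec b" "indep b ys"
  shows "indep (a + b) (block_list a b xs ys)"
  using xs
proof (induction xs)
  case Nil
  show ?case using ys
  proof (induction ys)
    case (Cons y ys)
    then show ?case
      using append_in_fspan_block_list[of "[]" a ys b "0\<^sub>v a" y] by (simp add: block_list_Nil_Cons)
  qed (simp add: block_list_Nil)
next
  case (Cons x xs)
  then show ?case
    using append_in_fspan_block_list[of xs a ys b x "0\<^sub>v b"] ys by (simp add: block_list_Cons)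
qed

lemma vsum_block_list:
  assumes xs: "set xs \<subseteq> carrier_vec a" and ys: "set ys \<subseteq> carrier_vec b"
  shows "vsum (a + b) (block_list a b xs ys) = vsum a xs @\<^sub>v vsum b ys"
  using xs
proof (induction xs)
  case Nil
  show ?case using ys
  proof (induction ys)
    case Nil
    show ?case by (simp add: block_list_Nil zero_append_zero)
  next
    case (Cons y ys)
    then show ?case
      using append_vec_plus[of "0\<^sub>v a" a "0\<^sub>v a" y b "vsum b ys"] by (simp add: block_list_Nil_Cons)
  qed
next
  case (Cons x xs)
  then show ?case
    using append_vec_plus[of x a "vsum a xs" "0\<^sub>v b" b "vsum b ys"] ys by (simp add: block_list_Cons)
qed

lemma totally_isotropic_block_list:
  assumes xs: "set xs \<subseteq> carrier_vec a" "totally_isotropic xs" and ys: "set ys \<subseteq> carrier_vec b" "totally_isotropic ys"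
  shows "totally_isotropic (block_list a b xs ys)"
proof -
  have sp: "(u @\<^sub>v v) \<bullet> (u' @\<^sub>v v') = u \<bullet> u' + v \<bullet> v'"
    if "u \<in> carrier_vec a" "u' \<in> carrier_vec a" "v \<in> carrier_vec b" "v' \<in> carrier_vec b" for u u' v v' :: "bit vec"
    using that scalar_prod_append by blast
  show ?thesis
    using assms by (auto simp: totally_isotropic_def block_list_def sp subset_iff)
qed

lemma outer_append_zero:
  assumes "x \<in> carrier_vec a"
  shows "outer (x @\<^sub>v 0\<^sub>v b) = four_block_mat (outer x) (0\<^sub>m a b) (0\<^sub>m b a) (0\<^sub>m b b)"
  using assms by (intro eq_matI) (auto simp: outer_def)

lemma outer_zero_append:
  assumes "y \<in> carrier_vec b"
  shows "outer (0\<^sub>v a @\<^sub>v y) = four_block_mat (0\<^sub>m a a) (0\<^sub>m a b) (0\<^sub>m b a) (outer y)"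
  using assms by (intro eq_matI) (auto simp: outer_def)

lemma add_block_diag:
  assumes "A \<in> carrier_mat a a" "A' \<in> carrier_mat a a" "B \<in> carrier_mat b b" "B' \<in> carrier_mat b b"
  shows "four_block_mat A (0\<^sub>m a b) (0\<^sub>m b a) B + four_block_mat A' (0\<^sub>m a b) (0\<^sub>m b a) B' =
    four_block_mat (A + A') (0\<^sub>m a b) (0\<^sub>m b a) (B + B' :: bit mat)"
  using assms by (subst add_four_block_mat[of _ a a _ b _ b]) auto

lemma gram_block_list:
  assumes xs: "set xs \<subseteq> carrier_vec a" and ys: "set ys \<subseteq> carrier_vec b"
  shows "gram (a + b) (block_list a b xs ys) = four_block_mat (gram a xs) (0\<^sub>m a b) (0\<^sub>m b a) (gram b ys)"
  using xs
proof (induction xs)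
  case Nil
  show ?case using ys
  proof (induction ys)
    case Nil
    show ?case by (simp add: block_list_Nil)
  next
    case (Cons y ys)
    then show ?case by (simp add: block_list_Nil_Cons outer_zero_append[of _ b] add_block_diag[of _ a _ _ b])
  qed
next
  case (Cons x xs)
  then show ?case using ys by (simp add: block_list_Cons outer_append_zero[of _ a] add_block_diag[of _ a _ _ b])
qed

lemma iso_decomp_block:
  assumes "iso_decomp a A xs" "iso_decomp b B ys"
  shows "iso_decomp (a + b) (four_block_mat A (0\<^sub>m a b) (0\<^sub>m b a) B) (block_list a b xs ys)"
proof -
  note A = iso_decompD[OF assms(1)] and B = iso_decompD[OF assms(2)]
  have "four_block_mat A (0\<^sub>m a b) (0\<^sub>m b a) B = 1\<^sub>m (a + b) + gram (a + b) (block_list a b xs ys)"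
    unfolding gram_block_list[OF A(1) B(1)] A(4) B(4) four_block_one_mat[symmetric]
    by (rule add_block_diag[symmetric]) (use A(1) B(1) in auto)
  then show ?thesis
    using block_list_carrier[OF A(1) B(1)] indep_block_list[OF A(1,2) B(1,2)]
      totally_isotropic_block_list[OF A(1,3) B(1,3)] by (simp add: iso_decomp_def)
qed

lemma fspan_snoc:
  assumes "x \<in> carrier_vec N" "set xs \<subseteq> carrier_vec N"
  shows "fspan N (xs @ [x]) = fspan N (x # xs)"
  using assms(2)
proof (induction xs)
  case (Cons y ys)
  then have IH: "fspan N (ys @ [x]) = fspan N (x # ys)" and y: "y \<in> carrier_vec N" by auto
  have "x + (y + v) = y + (x + v)" if "v \<in> carrier_vec N" for v
    using assms(1) y that by (intro eq_vecI) (auto simp: ac_simps)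
  then show ?case using assms(1) y unfolding append_Cons fspan.simps(2)[of N y] IH by auto
qed simp

lemma indep_rotate:
  assumes "x \<in> carrier_vec N" "set xs \<subseteq> carrier_vec N" "indep N (xs @ [x])"
  shows "indep N (x # xs)"
  using assms(2,3)
proof (induction xs)
  case (Cons y ys)
  have y: "y \<notin> fspan N (x # ys)" "y \<in> carrier_vec N" "set ys \<subseteq> carrier_vec N"
    using Cons.prems fspan_snoc[OF assms(1), of ys] by auto
  have IH: "indep N (x # ys)" using Cons by auto
  have "y + x = x + y" using comm_add_vec[OF assms(1) y(2)] by simp
  then show ?case using IH y assms(1) by auto
qed simp

text \<open>In a block sum the vector of a final J block comes last, while \<open>pair_type\<close>
  wants the two vectors with sum \<open>ones N\<close> in front; \<open>indep\<close> depends on the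
  order by its definition.\<close>

lemma iso_decomp_rotate:
  assumes "iso_decomp N A (xs @ [x])"
  shows "iso_decomp N A (x # xs)"
proof -
  note A = iso_decompD[OF assms]
  have c: "x \<in> carrier_vec N" "set xs \<subseteq> carrier_vec N" using A(1) by auto
  have "gram N (xs @ [x]) = gram N (x # xs)"
    using gram_append[OF c(2), of "[x]"] c comm_add_mat[OF gram_carrier[OF c(2)] outer_carrier[OF c(1)]]
    by (simp add: right_add_zero_mat[OF outer_carrier[OF c(1)]])
  then show ?thesis using A indep_rotate[OF c A(2)] by (simp add: iso_decomp_def totally_isotropic_def)
qed

section \<open>The listed matrices and their types\<close>

lemma I2_eq: "I2 = 1\<^sub>m 2"
  by (rule eq_matI) (auto simp: I2_def mat_of_rows_list_def less_2_cases_iff)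

lemma J2_eq: "J2 = 1\<^sub>m 2 + gram 2 [ones 2]"
  by (rule eq_matI) (auto simp: J2_def mat_of_rows_list_def less_2_cases_iff outer_def)

lemma iso_decomp_one: "iso_decomp N (1\<^sub>m N) []"
  by (simp add: iso_decomp_def totally_isotropic_def)

lemma iso_decomp_J2: "iso_decomp 2 J2 [ones 2]"
  unfolding iso_decomp_def J2_eq
  using ones_neq_zero[of 2] ones_scalar_prod_ones[of 2] by (simp add: totally_isotropic_def)

lemma block_pow_0: "block_pow A 0 = 0\<^sub>m 0 0"
  by (simp add: block_pow_def)

lemma block_pow_Suc:
  assumes "A \<in> carrier_mat a a" "block_pow A k \<in> carrier_mat b b"
  shows "block_pow A (Suc k) = four_block_mat A (0\<^sub>m a b) (0\<^sub>m b a) (block_pow A k)"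
  using assms by (simp add: block_pow_def Let_def)

lemma block_sum_eq:
  assumes "A \<in> carrier_mat a a" "B \<in> carrier_mat b b"
  shows "A \<oplus>\<^sub>b B = four_block_mat A (0\<^sub>m a b) (0\<^sub>m b a) B"
  using assms unfolding block_sum_def diag_block_mat.simps(2)[of A] diag_block_mat_singleton by (simp add: Let_def)

lemma block_pow_I2: "block_pow I2 m = 1\<^sub>m (2 * m)"
proof (induction m)
  case 0
  show ?case by (auto simp: block_pow_0)
next
  case (Suc m)
  then show ?case using block_pow_Suc[of I2 2 m "2 * m"] by (simp add: I2_eq)
qed

text \<open>J is I plus the square of the all-ones vector, so each block contributes its own
  all-ones vector, and these add up to \<open>ones (2 * k)\<close>.\<close>

lemma iso_decomp_block_pow_J2:
  "\<exists>xs. iso_decomp (2 * k) (block_pow J2 k) xs \<and> length xs = k \<and> vsum (2 * k) xs = ones (2 * k)"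
proof (induction k)
  case 0
  have "block_pow J2 0 = 1\<^sub>m 0" "0\<^sub>v 0 = ones 0" by (auto simp: block_pow_0)
  then show ?case using iso_decomp_one[of 0] by (intro exI[of _ "[]"]) auto
next
  case (Suc k)
  then obtain xs where xs: "iso_decomp (2 * k) (block_pow J2 k) xs" "length xs = k" "vsum (2 * k) xs = ones (2 * k)"
    by auto
  note X = iso_decompD[OF xs(1)] and J = iso_decompD[OF iso_decomp_J2]
  have eq: "2 * Suc k = 2 + 2 * k" by simp
  have "iso_decomp (2 * Suc k) (block_pow J2 (Suc k)) (block_list 2 (2 * k) [ones 2] xs)"
    unfolding eq block_pow_Suc[OF J(5) X(5)] by (rule iso_decomp_block[OF iso_decomp_J2 xs(1)])
  moreover have "vsum (2 * Suc k) (block_list 2 (2 * k) [ones 2] xs) = ones (2 * Suc k)"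
    unfolding eq vsum_block_list[OF J(1) X(1)] xs(3) ones_append by simp
  ultimately show ?case using xs(2) by (intro exI[of _ "block_list 2 (2 * k) [ones 2] xs"]) (simp add: length_block_list)
qed

lemma iso_decomp_block_sum:
  assumes "iso_decomp a A xs" "iso_decomp b B ys"
  shows "iso_decomp (a + b) (A \<oplus>\<^sub>b B) (block_list a b xs ys)"
  using iso_decomp_block[OF assms] block_sum_eq[OF iso_decompD(5)[OF assms(1)] iso_decompD(5)[OF assms(2)]] by simp

text \<open>All basis vectors vanish on the identity block, which is present as m > 0, but the
  all-ones vector does not.\<close>

lemma outside_type_block:
  assumes "m > 0" "k > 0"
  shows "outside_type (2 * (m + k)) k (block_pow I2 m \<oplus>\<^sub>b block_pow J2 k)"
proof -
  obtain ys where ys: "iso_decomp (2 * k) (block_pow J2 k) ys" "length ys = k"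
    using iso_decomp_block_pow_J2 by blast
  note Y = iso_decompD[OF ys(1)]
  let ?xs = "block_list (2 * m) (2 * k) [] ys"
  have "iso_decomp (2 * m + 2 * k) (block_pow I2 m \<oplus>\<^sub>b block_pow J2 k) ?xs"
    unfolding block_pow_I2 by (rule iso_decomp_block_sum[OF iso_decomp_one ys(1)])
  moreover have "ones (2 * m + 2 * k) \<notin> fspan (2 * m + 2 * k) ?xs"
    using append_in_fspan_block_list[of "[]" "2 * m" ys "2 * k" "ones (2 * m)" "ones (2 * k)"] Y(1)
      ones_neq_zero[of "2 * m"] assms(1) by (simp add: ones_append)
  moreover have "length ?xs = k" using ys(2) by (simp add: length_block_list)
  ultimately show ?thesis
    using assms(2) unfolding outside_type_def distrib_left by (intro exI[of _ ?xs]) auto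
qed

text \<open>The mirror of the identity block contributes the all-ones vector of that block, which
  completes the vectors of the J blocks to a list with all-ones sum.\<close>

lemma full_type_block:
  assumes "m > 0"
  shows "full_type (2 * (m + k)) (Suc k) (mirror (block_pow I2 m) \<oplus>\<^sub>b block_pow J2 k)"
proof -
  obtain ys where ys: "iso_decomp (2 * k) (block_pow J2 k) ys" "length ys = k" "vsum (2 * k) ys = ones (2 * k)"
    using iso_decomp_block_pow_J2 by blast
  note Y = iso_decompD[OF ys(1)]
  let ?xs = "block_list (2 * m) (2 * k) [ones (2 * m)] ys"
  have "iso_decomp (2 * m) (mirror (1\<^sub>m (2 * m))) [ones (2 * m)]"
    using iso_decomp_mirror[OF iso_decomp_one, of "2 * m"] ones_neq_zero[of "2 * m"] assms by simp
  then have "iso_decomp (2 * m + 2 * k) (mirror (block_pow I2 m) \<oplus>\<^sub>b block_pow J2 k) ?xs"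
    unfolding block_pow_I2 by (rule iso_decomp_block_sum[OF _ ys(1)])
  moreover have "vsum (2 * m + 2 * k) ?xs = ones (2 * m + 2 * k)"
    using vsum_block_list[of "[ones (2 * m)]" "2 * m" ys "2 * k"] Y(1) ys(3) by (simp add: ones_append)
  moreover have "length ?xs = Suc k" using ys(2) by (simp add: length_block_list)
  ultimately show ?thesis
    unfolding full_type_def distrib_left by (intro exI[of _ ?xs]) (auto simp: block_list_Cons)
qed

text \<open>The inner mirror contributes the all-ones vector of its block and the last J that of its
  two coordinates; together they give the all-ones vector. The k inner J blocks supply the other
  entries.\<close>

lemma pair_type_block:
  assumes "m > 0" "k > 0"
  shows "pair_type (2 * (m + k + 1)) (k + 2) (mirror (block_pow I2 m \<oplus>\<^sub>b block_pow J2 k) \<oplus>\<^sub>b J2)"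
proof -
  let ?N = "2 * (m + k)"
  obtain xs where xs: "iso_decomp ?N (block_pow I2 m \<oplus>\<^sub>b block_pow J2 k) xs" "length xs = k"
      "xs \<noteq> []" "ones ?N \<notin> fspan ?N xs"
    using outside_type_block[OF assms] by (auto simp: outside_type_def)
  let ?ws = "map (\<lambda>x. x @\<^sub>v 0\<^sub>v 2) xs"
  have "iso_decomp (?N + 2) (mirror (block_pow I2 m \<oplus>\<^sub>b block_pow J2 k) \<oplus>\<^sub>b J2)
      (block_list ?N 2 (ones ?N # xs) [ones 2])"
    by (rule iso_decomp_block_sum[OF iso_decomp_mirror[OF xs(1) _ xs(4)] iso_decomp_J2]) simp
  also have "block_list ?N 2 (ones ?N # xs) [ones 2] = ((ones ?N @\<^sub>v 0\<^sub>v 2) # ?ws) @ [0\<^sub>v ?N @\<^sub>v ones 2]"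
    by (simp add: block_list_def)
  finally have "iso_decomp (?N + 2) (mirror (block_pow I2 m \<oplus>\<^sub>b block_pow J2 k) \<oplus>\<^sub>b J2)
      ((0\<^sub>v ?N @\<^sub>v ones 2) # (ones ?N @\<^sub>v 0\<^sub>v 2) # ?ws)"
    by (rule iso_decomp_rotate)
  moreover have "(0\<^sub>v ?N @\<^sub>v ones 2) + (ones ?N @\<^sub>v 0\<^sub>v 2) = ones (?N + 2)"
    unfolding ones_append[of ?N 2] using append_vec_plus[of "0\<^sub>v ?N" ?N "ones ?N" "ones 2" 2 "0\<^sub>v 2"] by simp
  moreover have "?N + 2 = 2 * (m + k + 1)" by simp
  ultimately show ?thesis
    using xs(2,3) unfolding pair_type_def by (metis (no_types, lifting) One_nat_def add_2_eq_Suc' length_Cons length_map map_is_Nil_conv)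
qed

text \<open>Types count basis vectors, families count the J blocks of the power: the family
  parameter is k - 1 in the full and k - 2 in the pair case.\<close>

fun representative :: "nat \<Rightarrow> inv_type \<Rightarrow> bit mat" where
  "representative n (Outside k) = block_pow I2 (n - k) \<oplus>\<^sub>b block_pow J2 k"
| "representative n (Outside_mirror k) = mirror (block_pow I2 (n - k) \<oplus>\<^sub>b block_pow J2 k)"
| "representative n (Full k) = mirror (block_pow I2 (n - (k - 1))) \<oplus>\<^sub>b block_pow J2 (k - 1)"
| "representative n (Full_mirror k) = mirror (mirror (block_pow I2 (n - (k - 1))) \<oplus>\<^sub>b block_pow J2 (k - 1))"
| "representative n (Pair k) = mirror (block_pow I2 (n - (k - 2) - 1) \<oplus>\<^sub>b block_pow J2 (k - 2)) \<oplus>\<^sub>b J2"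

lemma has_type_representative:
  assumes "T \<in> valid_types n"
  shows "has_type (2 * n) T (representative n T)"
proof -
  have outside: "outside_type (2 * n) k (block_pow I2 (n - k) \<oplus>\<^sub>b block_pow J2 k)" if "1 \<le> k" "k \<le> n - 1" for k
    using outside_type_block[of "n - k" k] that by simp
  have full: "full_type (2 * n) k (mirror (block_pow I2 (n - (k - 1))) \<oplus>\<^sub>b block_pow J2 (k - 1))"
    if "1 \<le> k" "k \<le> n" for k
    using full_type_block[of "n - (k - 1)" "k - 1"] that by simp
  have pair: "pair_type (2 * n) k (mirror (block_pow I2 (n - (k - 2) - 1) \<oplus>\<^sub>b block_pow J2 (k - 2)) \<oplus>\<^sub>b J2)"
    if "3 \<le> k" "k \<le> n" for k
  proof -
    have "n - (k - 2) - 1 + (k - 2) + 1 = n" "k - 2 + 2 = k" using that by auto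
    then show ?thesis using pair_type_block[of "n - (k - 2) - 1" "k - 2"] that by simp
  qed
  show ?thesis
    using assms outside full pair by (auto simp: valid_types_def)
qed

lemma representatives_eq:
  assumes "n > 0"
  shows "representatives n = representative n ` valid_types n"
proof -
  have 1: "family1 n = (\<lambda>k. representative n (Outside k)) ` {1..n - 1}" by (auto simp: family1_def)
  have 2: "family2 n = (\<lambda>k. representative n (Full k)) ` {1..n}"
  proof (rule subset_antisym)
    show "family2 n \<subseteq> (\<lambda>k. representative n (Full k)) ` {1..n}"
    proof
      fix A assume "A \<in> family2 n"
      then obtain k where "k \<le> n - 1" "A = representative n (Full (Suc k))" by (auto simp: family2_def)
      then show "A \<in> (\<lambda>k. representative n (Full k)) ` {1..n}" using assms by (intro image_eqI[of _ _ "Suc k"]) auto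
    qed
    show "(\<lambda>k. representative n (Full k)) ` {1..n} \<subseteq> family2 n"
    proof (rule image_subsetI)
      fix k assume "k \<in> {1..n}"
      then show "representative n (Full k) \<in> family2 n"
        unfolding family2_def representative.simps by (intro CollectI exI[of _ "k - 1"]) auto
    qed
  qed
  have 3: "family3 n = (\<lambda>k. representative n (Pair k)) ` {3..n}"
  proof (rule subset_antisym)
    show "family3 n \<subseteq> (\<lambda>k. representative n (Pair k)) ` {3..n}"
    proof
      fix A assume "A \<in> family3 n"
      then obtain k where "1 \<le> k" "k \<le> n - 2" "A = representative n (Pair (k + 2))" by (auto simp: family3_def)
      then show "A \<in> (\<lambda>k. representative n (Pair k)) ` {3..n}" by (intro image_eqI[of _ _ "k + 2"]) auto
    qed
    show "(\<lambda>k. representative n (Pair k)) ` {3..n} \<subseteq> family3 n"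
    proof (rule image_subsetI)
      fix k assume "k \<in> {3..n}"
      then show "representative n (Pair k) \<in> family3 n"
        unfolding family3_def representative.simps by (intro CollectI exI[of _ "k - 2"]) auto
    qed
  qed
  show ?thesis
    unfolding representatives_def valid_types_def 1 2 3 image_Un image_image by simp
qed

lemma has_type_involution:
  assumes "has_type N T A" "even N"
  shows "A \<in> involutions N"
proof -
  have mir: "A \<in> involutions N" if "mirror A \<in> involutions N" using mirror_involution[OF that assms(2)] by simp
  show ?thesis
    using assms(1) iso_decomp_involution mir
    by (cases T) (auto simp: outside_type_def full_type_def pair_type_def)
qed

theorem theorem1p2:
  fixes n :: nat
  assumes "even n" and "n > 0"
  shows "(\<forall>A \<in> involutions n. \<forall>B \<in> involutions n.
            conj_class (TO n) A = conj_class (TO n) B \<longleftrightarrow> DD A = DD B)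
       \<and> card (conj_class (TO (2 * n)) ` involutions (2 * n)) = 5 * n - 4
       \<and> representatives n \<subseteq> involutions (2 * n)
       \<and> bij_betw (conj_class (TO (2 * n))) (representatives n)
            (conj_class (TO (2 * n)) ` involutions (2 * n))"
proof -
  \<comment> \<open>Stated for all even N > 0, since it serves n in the criterion and 2 * n for the
    representatives.\<close>
  have iff: "conj_class (TO N) A = conj_class (TO N) B \<longleftrightarrow> DD A = DD B"
    if N: "even N" "N > 0" and A: "A \<in> involutions N" and B: "B \<in> involutions N" for N A B
  proof
    assume "conj_class (TO N) A = conj_class (TO N) B"
    then obtain P where "P \<in> carrier (TO N)" "B = P * A * transpose_mat P"
      using conj_class_eqD[OF involutionsD(1)[OF A] involutionsD(1)[OF B]] by blast
    then show "DD A = DD B" using DD_conj[OF _ involutionsD(2)[OF A]] by simp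
  next
    assume eq: "DD A = DD B"
    obtain S T where "has_type N S A" "has_type N T B"
      using involution_has_type[OF A N] involution_has_type[OF B N] by blast
    moreover from this have "S = T" using type_of_DD_has_type[OF _ N] eq by metis
    ultimately show "conj_class (TO N) A = conj_class (TO N) B"
      using has_type_imp_conj_class_eq[OF A B] by blast
  qed
  let ?c = "conj_class (TO (2 * n))" and ?I = "involutions (2 * n)"
  \<comment> \<open>The bound n \<ge> 2, on which the count rests, comes from n being even and
    positive.\<close>
  have n: "even (2 * n)" "2 * n > 0" "n \<ge> 2" using assms by (auto elim: evenE)
  have reps: "representatives n = representative n ` valid_types n" by (rule representatives_eq[OF assms(2)])
  \<comment> \<open>Recovering the type from the representative makes both the map from types to
    representatives and the map from representatives to classes injective.\<close>
  have type: "type_of_DD (DD (representative n T)) = T" if "T \<in> valid_types n" for T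
    using type_of_DD_has_type[OF has_type_representative[OF that] n(1,2)] .
  have sub: "representatives n \<subseteq> ?I"
    unfolding reps using has_type_involution[OF has_type_representative n(1)] by blast
  have bij: "bij_betw ?c (representatives n) (?c ` ?I)"
  proof (rule bij_betw_imageI)
    show "inj_on ?c (representatives n)"
    proof (rule inj_onI)
      fix A B assume A: "A \<in> representatives n" and B: "B \<in> representatives n" and eq: "?c A = ?c B"
      have "DD A = DD B" using iff[OF n(1,2)] A B sub eq by blast
      moreover obtain S T where "S \<in> valid_types n" "A = representative n S" "T \<in> valid_types n" "B = representative n T"
        using A B unfolding reps by blast
      ultimately show "A = B" using type by metis
    qed
    show "?c ` representatives n = ?c ` ?I"
    proof (rule subset_antisym)
      show "?c ` ?I \<subseteq> ?c ` representatives n"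
      proof clarify
        fix A assume A: "A \<in> ?I"
        obtain T where T: "has_type (2 * n) T A" using involution_has_type[OF A n(1,2)] by blast
        note T' = has_type_valid[OF T]
        have "?c A = ?c (representative n T)"
          by (rule has_type_imp_conj_class_eq[OF A has_type_involution[OF has_type_representative[OF T'] n(1)] T has_type_representative[OF T']])
        then show "?c A \<in> ?c ` representatives n" unfolding reps using T' by blast
      qed
    qed (use sub in blast)
  qed
  have "inj_on (representative n) (valid_types n)" by (rule inj_on_inverseI[of _ "\<lambda>A. type_of_DD (DD A)"]) (rule type)
  then have "card (representatives n) = 5 * n - 4"
    unfolding reps using card_image card_valid_types[OF n(3)] by metis
  then have "card (?c ` ?I) = 5 * n - 4" using bij_betw_same_card[OF bij] by simp
  then show ?thesis using iff[OF assms] sub bij by blast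
qed

end
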